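(* Consider the RSU-assisted sequential channel-access decision problem described in the context, and let $$\lambda^* \;=\; \sup_{\mathcal{H}_s}\frac{\mathbb{E}[Y_{\mathcal{H}_s}]}{\mathbb{E}[T_{\mathcal{H}_s}]},$$ the supremum being over all admissible strategies $\mathcal{H}_s$. For $i\in\{1,\dots,K\}$, $\gamma\ge 0$ and $\lambda>0$ let $$W_i(\gamma,\lambda)=\mathbb{E}\Big[\max\big\{\tau_{d,1}\max\{\log_2(1+\gamma),\tfrac12\log_2(1+\gamma_{i,r})\}-\lambda\tau_d,\;-\lambda\tau_1\big\}\Big],\qquad \gamma_{i,r}=\gamma+\frac{\Gamma_{1,i}\Gamma_{2,i}}{\Gamma_{1,i}+\Gamma_{2,i}+1},$$ where $\Gamma_{1,i},\Gamma_{2,i}$ are independent exponential random variables with means $\bar\gamma_{1,i}$ and $\bar\gamma_{2,i}$ respectively. (Thus $W_i(\gamma,\lambda)$ is the conditional expectation of $\max\{\tau_{d,1}\max\{R_{d,k},R_{r,k}\}-\lambda\tau_d,-\lambda\tau_1\}$ given $w(k)=i$ and $\gamma_i(k)=\gamma$.) Then: (i) $\lambda^*$ exists, and it is the unique solution $\lambda>0$ of $$\mathbb{E}\Big[\max\big\{\tau_d R_{d,k}-\lambda\tau_d,\;0,\;W_{w(k)}\big(\gamma_{w(k)}(k),\lambda\big)\big\}\Big]=\lambda\,\tau_o .$$ (ii) The following strategy attains the supremum $\lambda^*$: start with $k=1$ and continue until a stop occurs; after the $k$-th successful contention, • at the first observation of stage $k$: if $\tau_d R_{d,k}-\lambda^*\tau_d\ge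 \max\{W_{w(k)}(\gamma_{w(k)}(k),\lambda^* ),0\}$, stop and transmit over the V2V link; if $\tau_d R_{d,k}-\lambda^*\tau_d<0$ and $W_{w(k)}(\gamma_{w(k)}(k),\lambda^* )<0$, re-contend (proceed to the $(k+1)$-th contention); otherwise probe the RSU; • at the second observation of stage $k$ (after probing): if $\max\{R_{d,k},R_{r,k}\}\ge\lambda^*$, stop; otherwise re-contend (proceed to the $(k+1)$-th contention).
   Context: Network: $K\ge1$ vehicle pairs (source $S_i$, destination $D_i$), $i=1,\dots,K$, and one roadside unit (RSU) $R$ acting as an amplify-and-forward relay. Positive constants: transmit powers $P_s,P_r$, noise power $N_0$, path-loss exponents $\alpha_1,\alpha_2$, distances $d_{SD,i}=\|\mathbf{x}_{S,i}-\mathbf{x}_{D,i}\|_2$, $d_{SR,i}=\|\mathbf{x}_{S,i}-\mathbf{x}_R\|_2$, $d_{RD,i}=\|\mathbf{x}_R-\mathbf{x}_{D,i}\|_2$ (all positive). Define means $\bar\gamma_i=P_s d_{SD,i}^{-\alpha_1}/N_0$, $\bar\gamma_{1,i}=P_s d_{SR,i}^{-\alpha_2}/N_0$, $\bar\gamma_{2,i}=P_r d_{RD,i}^{-\alpha_2}/N_0$. Durations: RTS and CTS durations $\tau_R,\tau_C>0$, idle slot length $\delta>0$, probing duration $\tau_1=\tau_R+\tau_C$, data duration $\tau_d>\tau_1$, and $\tau_{d,1}=\tau_d-\tau_1$. Contention: each source transmits an RTS in each slot independently with probability $p_0\in(0,1)$. A slot is idle with probability $(1-p_0)^K$ (length $\delta$),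 successful with probability $q=Kp_0(1-p_0)^{K-1}$ (length $\tau_R+\tau_C$), and a collision otherwise (length $\tau_R$); slots are independent. The $k$-th contention time $t_w(k)$ is the total duration of the slots up to and including the next successful slot; the $t_w(k)$ are i.i.d. with mean $$\tau_o=\tau_R+\tau_C+\frac{(1-p_0)^K\delta}{q}+\frac{(1-(1-p_0)^K-q)\tau_R}{q}.$$ The winner index $w(k)$ of the $k$-th successful contention is uniformly distributed on $\{1,\dots,K\}$, i.i.d. over $k$ and independent of the contention times. Channels: for each stage $k$ and pair $i$, the SNRs $\gamma_i(k)$ (V2V link), $\gamma_{1,i}(k)$ (source-to-RSU) and $\gamma_{2,i}(k)$ (RSU-to-destination) are independent exponential random variables with means $\bar\gamma_i,\bar\gamma_{1,i},\bar\gamma_{2,i}$, independent across $k$ and of the contention process. Write $R_{d,k}=\log_2(1+\gamma_{w(k)}(k))$, $\gamma_{w(k),r}(k)=\gamma_{w(k)}(k)+\frac{\gamma_{1,w(k)}(k)\gamma_{2,w(k)}(k)}{\gamma_{1,w(k)}(k)+\gamma_{2,w(k)}(k)+1}$, and $R_{r,k}=\tfrac12\log_2(1+\gamma_{w(k),r}(k))$. Decision process: at stage $k$ (after the $k$-th successful contention) the decision maker observes $w(k)$ and $\gamma_{w(k)}(k)$ (first observation) and chooses stop, re-contend, or probe RSU. If it probes, it additionally observes $\gamma_{1,w(k)}(k),\gamma_{2,w(k)}(k)$ (second observation) and chooses stop or re-contend. Re-contending moves to stage $k+1$. A strategy $\mathcal{H}_s$ is a rule making these choices based only on observations made so far; it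 is admissible if it stops with probability one and has $\mathbb{E}[T_{\mathcal{H}_s}]<\infty$. If the strategy stops at stage $k$, the reward is $Y=\tau_d R_{d,k}$ if it stopped at the first observation and $Y=\tau_{d,1}\max\{R_{d,k},R_{r,k}\}$ if it stopped after probing; the time cost is $T=\sum_{l=1}^{k}t_w(l)+\tau_1\cdot\#\{l\le k-1:\text{the RSU was probed at stage }l\}+\tau_d$. *)

theory Defs
  imports "HOL-Probability.Probability"
begin

text \<open>Mean SNRs, computed from positions (vehicle pairs indexed 1..K).\<close>
definition gbarD :: "real \<Rightarrow> real \<Rightarrow> real \<Rightarrow> (nat \<Rightarrow> 'v::euclidean_space) \<Rightarrow> (nat \<Rightarrow> 'v) \<Rightarrow> nat \<Rightarrow> real" where
  "gbarD Ps N0 alpha1 xS xD i = Ps * (norm (xS i - xD i)) powr (- alpha1) / N0"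

definition gbar1 :: "real \<Rightarrow> real \<Rightarrow> real \<Rightarrow> (nat \<Rightarrow> 'v::euclidean_space) \<Rightarrow> 'v \<Rightarrow> nat \<Rightarrow> real" where
  "gbar1 Ps N0 alpha2 xS xR i = Ps * (norm (xS i - xR)) powr (- alpha2) / N0"

definition gbar2 :: "real \<Rightarrow> real \<Rightarrow> real \<Rightarrow> 'v::euclidean_space \<Rightarrow> (nat \<Rightarrow> 'v) \<Rightarrow> nat \<Rightarrow> real" where
  "gbar2 Pr N0 alpha2 xR xD i = Pr * (norm (xR - xD i)) powr (- alpha2) / N0"

definition exp_mean :: "real \<Rightarrow> real measure" where
  "exp_mean m = density lborel (exponential_density (1 / m))"

datatype slot = Idle | Coll | Succ

text \<open>Slot outcome: idle w.p. (1-p0)^K, success w.p. q = K p0 (1-p0)^(K-1), collision otherwise.\<close>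
definition slot_pmf :: "real \<Rightarrow> nat \<Rightarrow> slot pmf" where
  "slot_pmf p0 K =
     bind_pmf (bernoulli_pmf ((1 - p0) ^ K)) (\<lambda>idle.
       if idle then return_pmf Idle
       else map_pmf (\<lambda>b. if b then Succ else Coll)
              (bernoulli_pmf ((real K * p0 * (1 - p0) ^ (K - 1)) / (1 - (1 - p0) ^ K))))"

definition slot_dur :: "real \<Rightarrow> real \<Rightarrow> real \<Rightarrow> slot \<Rightarrow> real" where
  "slot_dur tauR tauC delta s = (case s of Idle \<Rightarrow> delta | Coll \<Rightarrow> tauR | Succ \<Rightarrow> tauR + tauC)"

text \<open>Data of one stage: the slot sequence of the contention, the winner w,
  and the SNR vectors gamma_i, gamma_{1,i}, gamma_{2,i} (i = 1..K).\<close>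
type_synonym stage = "(nat \<Rightarrow> slot) \<times> nat \<times> (nat \<Rightarrow> real) \<times> (nat \<Rightarrow> real) \<times> (nat \<Rightarrow> real)"

definition st_slots :: "stage \<Rightarrow> nat \<Rightarrow> slot" where "st_slots x = fst x"
definition st_w :: "stage \<Rightarrow> nat" where "st_w x = fst (snd x)"
definition st_g :: "stage \<Rightarrow> nat \<Rightarrow> real" where "st_g x = fst (snd (snd x))"
definition st_g1 :: "stage \<Rightarrow> nat \<Rightarrow> real" where "st_g1 x = fst (snd (snd (snd x)))"
definition st_g2 :: "stage \<Rightarrow> nat \<Rightarrow> real" where "st_g2 x = snd (snd (snd (snd x)))"

definition t_w :: "real \<Rightarrow> real \<Rightarrow> real \<Rightarrow> stage \<Rightarrow> real" where
  "t_w tauR tauC delta x =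
     (let s = st_slots x; n = (LEAST j. s j = Succ)
      in (\<Sum>j<n. slot_dur tauR tauC delta (s j)) + slot_dur tauR tauC delta Succ)"

definition stage_M :: "real \<Rightarrow> nat \<Rightarrow> (nat \<Rightarrow> real) \<Rightarrow> (nat \<Rightarrow> real) \<Rightarrow> (nat \<Rightarrow> real) \<Rightarrow> stage measure" where
  "stage_M p0 K gD g1 g2 =
     (PiM UNIV (\<lambda>_. measure_pmf (slot_pmf p0 K))) \<Otimes>\<^sub>M
     measure_pmf (pmf_of_set {1..K}) \<Otimes>\<^sub>M
     (PiM {1..K} (\<lambda>i. exp_mean (gD i))) \<Otimes>\<^sub>M
     (PiM {1..K} (\<lambda>i. exp_mean (g1 i))) \<Otimes>\<^sub>M
     (PiM {1..K} (\<lambda>i. exp_mean (g2 i)))"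

text \<open>The whole process: i.i.d. stages k = 0,1,2,... (stage k here is the paper's stage k+1).\<close>
definition Omega :: "real \<Rightarrow> nat \<Rightarrow> (nat \<Rightarrow> real) \<Rightarrow> (nat \<Rightarrow> real) \<Rightarrow> (nat \<Rightarrow> real) \<Rightarrow> (nat \<Rightarrow> stage) measure" where
  "Omega p0 K gD g1 g2 = PiM UNIV (\<lambda>_. stage_M p0 K gD g1 g2)"

text \<open>Mean contention time tau_o.\<close>
definition tau_o :: "real \<Rightarrow> nat \<Rightarrow> real \<Rightarrow> real \<Rightarrow> real \<Rightarrow> real" where
  "tau_o p0 K tauR tauC delta =
     (let q = real K * p0 * (1 - p0) ^ (K - 1)
      in tauR + tauC + (1 - p0) ^ K * delta / q + (1 - (1 - p0) ^ K - q) * tauR / q)"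

definition g_relay :: "real \<Rightarrow> real \<Rightarrow> real \<Rightarrow> real" where
  "g_relay g a b = g + a * b / (a + b + 1)"

datatype act1 = Stop1 | Recont | Probe

text \<open>Observation record of a past stage: winner, its V2V SNR, and (if the RSU was probed)
  the two relay SNRs.\<close>
type_synonym obs = "nat \<times> real \<times> (real \<times> real) option"

text \<open>A (deterministic) strategy: first-observation rule and second-observation rule
  (True = stop), both depending on the past observations and the current ones.\<close>
type_synonym strategy =
  "(obs list \<Rightarrow> nat \<Rightarrow> real \<Rightarrow> act1) \<times> (obs list \<Rightarrow> nat \<Rightarrow> real \<Rightarrow> real \<Rightarrow> real \<Rightarrow> bool)"

datatype outcome = StopV2V | StopRelay | Cont bool  (* Cont b: re-contend, b = RSU probed *)

definition stage_res :: "strategy \<Rightarrow> obs list \<Rightarrow> stage \<Rightarrow> outcome" where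
  "stage_res H h x =
     (let w = st_w x; g = st_g x w in
      case fst H h w g of
        Stop1 \<Rightarrow> StopV2V
      | Recont \<Rightarrow> Cont False
      | Probe \<Rightarrow> (if snd H h w g (st_g1 x w) (st_g2 x w) then StopRelay else Cont True))"

definition obs_of :: "stage \<Rightarrow> outcome \<Rightarrow> obs" where
  "obs_of x r = (st_w x, st_g x (st_w x),
                 (if r = StopV2V \<or> r = Cont False then None
                  else Some (st_g1 x (st_w x), st_g2 x (st_w x))))"

primrec hist :: "strategy \<Rightarrow> (nat \<Rightarrow> stage) \<Rightarrow> nat \<Rightarrow> obs list" where
  "hist H \<omega> 0 = []"
| "hist H \<omega> (Suc k) = hist H \<omega> k @ [obs_of (\<omega> k) (stage_res H (hist H \<omega> k) (\<omega> k))]"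

definition res :: "strategy \<Rightarrow> (nat \<Rightarrow> stage) \<Rightarrow> nat \<Rightarrow> outcome" where
  "res H \<omega> k = stage_res H (hist H \<omega> k) (\<omega> k)"

definition stops :: "outcome \<Rightarrow> bool" where
  "stops r \<longleftrightarrow> r = StopV2V \<or> r = StopRelay"

definition stop_stage :: "strategy \<Rightarrow> (nat \<Rightarrow> stage) \<Rightarrow> nat" where
  "stop_stage H \<omega> = (LEAST k. stops (res H \<omega> k))"

definition reward :: "real \<Rightarrow> real \<Rightarrow> strategy \<Rightarrow> (nat \<Rightarrow> stage) \<Rightarrow> real" where
  "reward tau_d tau1 H \<omega> =
     (let k = stop_stage H \<omega>; x = \<omega> k; w = st_w x;
          Rd = log 2 (1 + st_g x w);
          Rr = 1/2 * log 2 (1 + g_relay (st_g x w) (st_g1 x w) (st_g2 x w))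
      in if res H \<omega> k = StopV2V then tau_d * Rd else (tau_d - tau1) * max Rd Rr)"

definition cost :: "real \<Rightarrow> real \<Rightarrow> real \<Rightarrow> real \<Rightarrow> strategy \<Rightarrow> (nat \<Rightarrow> stage) \<Rightarrow> real" where
  "cost tauR tauC delta tau_d H \<omega> =
     (let k = stop_stage H \<omega>
      in (\<Sum>l\<le>k. t_w tauR tauC delta (\<omega> l))
         + (tauR + tauC) * real (card {l. l < k \<and> res H \<omega> l = Cont True}) + tau_d)"

definition admissible :: "(nat \<Rightarrow> stage) measure \<Rightarrow> (strategy \<Rightarrow> (nat \<Rightarrow> stage) \<Rightarrow> real)
     \<Rightarrow> (strategy \<Rightarrow> (nat \<Rightarrow> stage) \<Rightarrow> real) \<Rightarrow> strategy \<Rightarrow> bool" where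
  "admissible M Y T H \<longleftrightarrow>
     (AE \<omega> in M. \<exists>k. stops (res H \<omega> k)) \<and>
     Y H \<in> borel_measurable M \<and> T H \<in> borel_measurable M \<and>
     (\<integral>\<^sup>+ \<omega>. ennreal (T H \<omega>) \<partial>M) < \<infinity>"

text \<open>E[Y]/E[T] (in ennreal, so no integrability of Y has to be presupposed).\<close>
definition ratio :: "(nat \<Rightarrow> stage) measure \<Rightarrow> (strategy \<Rightarrow> (nat \<Rightarrow> stage) \<Rightarrow> real)
     \<Rightarrow> (strategy \<Rightarrow> (nat \<Rightarrow> stage) \<Rightarrow> real) \<Rightarrow> strategy \<Rightarrow> ennreal" where
  "ratio M Y T H = (\<integral>\<^sup>+ \<omega>. ennreal (Y H \<omega>) \<partial>M) / (\<integral>\<^sup>+ \<omega>. ennreal (T H \<omega>) \<partial>M)"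

definition W :: "real \<Rightarrow> real \<Rightarrow> (nat \<Rightarrow> real) \<Rightarrow> (nat \<Rightarrow> real) \<Rightarrow> nat \<Rightarrow> real \<Rightarrow> real \<Rightarrow> real" where
  "W tau_d tau1 g1 g2 i g lam =
     (\<integral>z. max ((tau_d - tau1) * max (log 2 (1 + g)) (1/2 * log 2 (1 + g_relay g (fst z) (snd z)))
                 - lam * tau_d) (- lam * tau1)
        \<partial>(exp_mean (g1 i) \<Otimes>\<^sub>M exp_mean (g2 i)))"

definition opt_strategy :: "real \<Rightarrow> real \<Rightarrow> (nat \<Rightarrow> real) \<Rightarrow> (nat \<Rightarrow> real) \<Rightarrow> real \<Rightarrow> strategy" where
  "opt_strategy tau_d tau1 g1 g2 lam =
     ((\<lambda>h w g. let a = tau_d * log 2 (1 + g) - lam * tau_d; b = W tau_d tau1 g1 g2 w g lam in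
                 if a \<ge> max b 0 then Stop1 else if a < 0 \<and> b < 0 then Recont else Probe),
      (\<lambda>h w g a b. max (log 2 (1 + g)) (1/2 * log 2 (1 + g_relay g a b)) \<ge> lam))"

end

(* For a price lam of time, let Phi lam be the expected best one-stage gain
     max {tau_d R_d - lam tau_d, 0, W}.
   Conditioning on the first stage shows inductively that E[Y] - lam E[T] <= 0 for every strategy
   as soon as Phi lam = lam tau_o, and a root exists uniquely because Phi is antimonotone and
   Lipschitz. For the threshold strategy each stage decision depends on that stage alone, so Wald's
   identity turns E[Y] and E[T] into one-stage expectations, which satisfy E[Y] = lam E[T] with
   equality by the choice of lam. *)

theory Submission
  imports Defs
begin

subsection \<open>Stopping an i.i.d. sequence\<close>

text \<open>Expectations are taken in \<open>ennreal\<close>, so that no integrability of the reward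
  is presupposed. The price is that a gain \<open>Y - lam * T\<close> cannot be formed: every
  comparison of gains is stated with the negative terms moved to the other side, and
  \<open>lam * tau1\<close> is added on both sides whenever probing is involved, because a fruitless
  probe has gain \<open>- lam * tau1\<close>. Probing is worth its price only on average over the
  relay SNRs, so within a stage pointwise estimates are not enough. The stage integral is therefore
  ordered with the relay SNRs innermost, where the choice whether to probe has become a constant.
  The induction behind the upper bound truncates the reward, and this loses reward; it can thus give
  only one direction. Equality for the threshold strategy is obtained independently, from Wald's
  identity over stages. The same identity, applied to the slots of a single contention, identifies
  \<open>tau_o\<close> as the mean contention time.\<close>

lemma nn_integral_PiM_case_nat:
  assumes "prob_space M" and [measurable]: "f \<in> borel_measurable (PiM (UNIV :: nat set) (\<lambda>_. M))"
  shows "(\<integral>\<^sup>+\<omega>. f \<omega> \<partial>PiM UNIV (\<lambda>_. M)) =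
         (\<integral>\<^sup>+x. \<integral>\<^sup>+\<omega>. f (case_nat x \<omega>) \<partial>PiM (UNIV :: nat set) (\<lambda>_. M) \<partial>M)"
proof -
  interpret prob_space M by fact
  interpret sequence_space M by unfold_locales
  have m: "(\<lambda>(x, \<omega>). case_nat x \<omega>) \<in> measurable (M \<Otimes>\<^sub>M S) S"
    by measurable
  have "(\<integral>\<^sup>+\<omega>. f \<omega> \<partial>S) = (\<integral>\<^sup>+\<omega>. f \<omega> \<partial>distr (M \<Otimes>\<^sub>M S) S (\<lambda>(x, \<omega>). case_nat x \<omega>))"
    by (simp only: PiM_iter)
  also have "\<dots> = (\<integral>\<^sup>+z. f (case_nat (fst z) (snd z)) \<partial>(M \<Otimes>\<^sub>M S))"
    using m by (simp add: nn_integral_distr split_beta')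
  also have "\<dots> = (\<integral>\<^sup>+x. \<integral>\<^sup>+\<omega>. f (case_nat x \<omega>) \<partial>S \<partial>M)"
    by (subst P.nn_integral_fst[symmetric]) auto
  finally show ?thesis .
qed

lemma AE_PiM_case_nat:
  assumes "prob_space M" and "AE \<omega> in PiM (UNIV :: nat set) (\<lambda>_. M). P \<omega>"
  shows "AE x in M. AE \<omega> in PiM (UNIV :: nat set) (\<lambda>_. M). P (case_nat x \<omega>)"
proof -
  interpret prob_space M by fact
  interpret sequence_space M by unfold_locales
  have m: "(\<lambda>(x, \<omega>). case_nat x \<omega>) \<in> measurable (M \<Otimes>\<^sub>M S) S"
    by measurable
  have "AE \<omega> in distr (M \<Otimes>\<^sub>M S) S (\<lambda>(x, \<omega>). case_nat x \<omega>). P \<omega>"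
    using assms(2) by (simp only: PiM_iter)
  from AE_distrD[OF m this] have AE: "AE z in M \<Otimes>\<^sub>M S. P (case_nat (fst z) (snd z))"
    by (simp add: split_beta')
  interpret MS: pair_sigma_finite M S ..
  from MS.AE_pair[OF AE] show ?thesis by simp
qed

text \<open>The event that \<open>Q\<close> has not occurred before \<open>n\<close> looks only at
  earlier coordinates and is independent of the \<open>n\<close>-th one. Peeling off the first
  coordinate contributes one factor of the probability that \<open>Q\<close> fails.\<close>

lemma nn_integral_PiM_until_nth:
  assumes M: "prob_space M" and Q[measurable]: "Measurable.pred M Q"
    and f[measurable]: "f \<in> borel_measurable M"
  shows "(\<integral>\<^sup>+\<omega>. f (\<omega> n) * of_bool (\<forall>j<n. \<not> Q (\<omega> j)) \<partial>PiM (UNIV :: nat set) (\<lambda>_. M)) =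
         (\<integral>\<^sup>+x. f x \<partial>M) * emeasure M {x \<in> space M. \<not> Q x} ^ n"
proof (induction n)
  interpret prob_space M by fact
  interpret sequence_space M by unfold_locales
  case 0
  show ?case
    by (subst nn_integral_PiM_case_nat[OF M]) (simp_all add: P.emeasure_space_1)
next
  interpret prob_space M by fact
  interpret sequence_space M by unfold_locales
  case (Suc n)
  let ?I = "\<integral>\<^sup>+x. f x \<partial>M" and ?p = "emeasure M {x \<in> space M. \<not> Q x}"
  have "(\<integral>\<^sup>+\<omega>. f (\<omega> (Suc n)) * of_bool (\<forall>j<Suc n. \<not> Q (\<omega> j)) \<partial>S) =
        (\<integral>\<^sup>+x. \<integral>\<^sup>+\<omega>. f (\<omega> n) * of_bool (\<forall>j<n. \<not> Q (\<omega> j)) * indicator {x \<in> space M. \<not> Q x} x \<partial>S \<partial>M)"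
    by (subst nn_integral_PiM_case_nat[OF M])
       (auto simp: All_less_Suc2 indicator_def intro!: nn_integral_cong)
  also have "\<dots> = (\<integral>\<^sup>+x. (?I * ?p ^ n) * indicator {x \<in> space M. \<not> Q x} x \<partial>M)"
    by (subst nn_integral_multc) (simp_all add: Suc)
  also have "\<dots> = ?I * ?p ^ Suc n"
    by (subst nn_integral_cmult_indicator) (measurable, simp add: ac_simps)
  finally show ?case .
qed

text \<open>The indicator tests only indices strictly below \<open>n\<close>, so the hitting index
  itself is still counted. As a series of fixed range, the random sum can be integrated term by
  term.\<close>

lemma suminf_until_Least:
  fixes f :: "nat \<Rightarrow> ennreal"
  assumes "P k"
  shows "(\<Sum>n. f n * of_bool (\<forall>j<n. \<not> P j)) = (\<Sum>n\<le>(LEAST k. P k). f n)"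
proof -
  let ?N = "LEAST k. P k"
  have "P ?N" using assms by (rule LeastI)
  then have "(\<Sum>n. f n * of_bool (\<forall>j<n. \<not> P j)) = (\<Sum>n\<le>?N. f n * of_bool (\<forall>j<n. \<not> P j))"
    by (intro suminf_finite) (auto simp: not_le)
  also have "\<dots> = (\<Sum>n\<le>?N. f n)"
    by (intro sum.cong refl) (auto dest: not_less_Least order_less_le_trans)
  finally show ?thesis .
qed

text \<open>Wald's identity for a first hitting time: the \<open>n\<close>-th summand survives with
  probability \<open>(1 - p) ^ n\<close>, and the geometric series has the sum \<open>1 / p\<close>,
  the mean number of trials.\<close>

lemma
  assumes M: "prob_space M" and Q[measurable]: "Measurable.pred M Q"
    and pos: "emeasure M {x \<in> space M. Q x} \<noteq> 0"
  shows AE_PiM_hits: "AE \<omega> in PiM (UNIV :: nat set) (\<lambda>_. M). \<exists>k. Q (\<omega> k)"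
    and nn_integral_PiM_sum_until_hit: "f \<in> borel_measurable M \<Longrightarrow>
      (\<integral>\<^sup>+\<omega>. (\<Sum>n\<le>(LEAST k. Q (\<omega> k)). f (\<omega> n)) \<partial>PiM (UNIV :: nat set) (\<lambda>_. M)) =
      (\<integral>\<^sup>+x. f x \<partial>M) / emeasure M {x \<in> space M. Q x}"
proof -
  interpret prob_space M by fact
  note em = emeasure_eq_measure and em1 = emeasure_space_1 and pc = prob_compl
  let ?p = "measure M {x \<in> space M. Q x}" and ?q = "measure M {x \<in> space M. \<not> Q x}"
  have p: "?p > 0" using pos by (simp add: em zero_less_measure_iff del: prob_Collect_eq_0)
  have q: "?q = 1 - ?p"
  proof -
    have "{x \<in> space M. \<not> Q x} = space M - {x \<in> space M. Q x}" by auto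
    then show ?thesis by (simp add: pc)
  qed
  have geo: "(\<Sum>n. emeasure M {x \<in> space M. \<not> Q x} ^ n) = 1 / emeasure M {x \<in> space M. Q x}"
  proof -
    have "(\<lambda>n. ?q ^ n) sums (1 / (1 - ?q))"
      using p q by (intro geometric_sums) (auto simp: measure_nonneg)
    then have "(\<Sum>n. ennreal (?q ^ n)) = ennreal (1 / ?p)"
      by (intro suminf_ennreal_eq) (auto simp: q)
    then show ?thesis
      using p by (simp add: em ennreal_power divide_ennreal flip: ennreal_1)
  qed
  have series: "(\<integral>\<^sup>+\<omega>. (\<Sum>n. f (\<omega> n) * of_bool (\<forall>j<n. \<not> Q (\<omega> j))) \<partial>PiM UNIV (\<lambda>_. M)) =
      (\<integral>\<^sup>+x. f x \<partial>M) / emeasure M {x \<in> space M. Q x}" if [measurable]: "f \<in> borel_measurable M" for f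
    by (subst nn_integral_suminf)
       (simp_all add: nn_integral_PiM_until_nth[OF M] ennreal_suminf_cmult geo ennreal_times_divide)
  \<comment> \<open>For \<open>f = 1\<close> the series counts the trials. Its mean
    \<open>1 / p\<close> is finite, so it is almost surely finite, whereas it is infinite on a run
    that never meets \<open>Q\<close>.\<close>
  have "(\<integral>\<^sup>+\<omega>. (\<Sum>n. of_bool (\<forall>j<n. \<not> Q (\<omega> j))) \<partial>PiM (UNIV :: nat set) (\<lambda>_. M)) \<noteq> \<infinity>"
    using series[of "\<lambda>_. 1"] pos
    by (simp add: em1 ennreal_divide_eq_top_iff)
  from nn_integral_PInf_AE[OF _ this]
  have "AE \<omega> in PiM (UNIV :: nat set) (\<lambda>_. M). (\<Sum>n. of_bool (\<forall>j<n. \<not> Q (\<omega> j)) :: ennreal) \<noteq> \<infinity>"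
    by simp
  then show hits: "AE \<omega> in PiM (UNIV :: nat set) (\<lambda>_. M). \<exists>k. Q (\<omega> k)"
  proof eventually_elim
    case (elim \<omega>)
    show ?case
    proof (rule ccontr)
      assume "\<nexists>k. Q (\<omega> k)"
      then have "(\<Sum>n. of_bool (\<forall>j<n. \<not> Q (\<omega> j)) :: ennreal) = (\<Sum>n. 1)" by simp
      also have "\<dots> = \<infinity>"
        using ennreal_suminf_bound_add nn_integral_count_space_nat[of "\<lambda>_. 1"] by simp
      finally show False using elim by simp
    qed
  qed
  show "(\<integral>\<^sup>+\<omega>. (\<Sum>n\<le>(LEAST k. Q (\<omega> k)). f (\<omega> n)) \<partial>PiM (UNIV :: nat set) (\<lambda>_. M)) =
      (\<integral>\<^sup>+x. f x \<partial>M) / emeasure M {x \<in> space M. Q x}" if "f \<in> borel_measurable M" for f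
    unfolding series[OF that, symmetric]
    using hits by (intro nn_integral_cong_AE) (auto elim!: eventually_mono simp: suminf_until_Least)
qed

subsection \<open>The contention time\<close>

text \<open>This is the probability that at most one of \<open>K\<close> independent sources
  transmits. The induction conditions on one source: if it is silent, at most one of the others may
  transmit, otherwise none of them. The bound makes the success parameter in \<open>slot_pmf\<close>
  a probability.\<close>

lemma success_plus_idle_le_1:
  fixes p :: real
  assumes "0 \<le> p" "p \<le> 1"
  shows "(1 - p) ^ K + real K * p * (1 - p) ^ (K - 1) \<le> 1"
proof (induction K)
  case (Suc K)
  have "(1 - p) ^ Suc K + real (Suc K) * p * (1 - p) ^ (Suc K - 1)
      = (1 - p) * ((1 - p) ^ K + real K * p * (1 - p) ^ (K - 1)) + p * (1 - p) ^ K"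
    by (cases K) (simp_all add: algebra_simps)
  also have "\<dots> \<le> (1 - p) * 1 + p * 1"
    using assms Suc by (intro add_mono mult_left_mono power_le_one) auto
  finally show ?case by simp
qed simp

section \<open>Exponential laws and the product space of a single stage\<close>

lemma prob_space_exp_mean: "0 < m \<Longrightarrow> prob_space (exp_mean m)"
  unfolding exp_mean_def by (rule prob_space_exponential_density) simp

lemma sets_exp_mean[measurable_cong]: "sets (exp_mean m) = sets borel"
  by (simp add: exp_mean_def)

text \<open>Finiteness of the density suffices, whatever the sign of \<open>m\<close>. Measurability
  statements about the winner range over all indices, also those outside \<open>{1..K}\<close>,
  where the means are arbitrary and \<open>exp_mean\<close> may fail to be a probability
  measure.\<close>

lemma sigma_finite_exp_mean: "sigma_finite_measure (exp_mean m)"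
  unfolding exp_mean_def
  by (subst sigma_finite_measure.sigma_finite_iff_density_finite[OF sigma_finite_lborel]) auto

lemma AE_exp_mean_nonneg: "AE x in exp_mean m. 0 \<le> x"
  unfolding exp_mean_def by (subst AE_density) (auto simp: erlang_density_def)

lemma nn_integral_exp_mean:
  assumes "0 < m"
  shows "(\<integral>\<^sup>+x. ennreal x \<partial>exp_mean m) = ennreal m"
proof -
  have "(\<integral>\<^sup>+x. ennreal x \<partial>exp_mean m) = (\<integral>\<^sup>+x. ennreal (erlang_density 0 (1 / m) x * x ^ 1) \<partial>lborel)"
    using assms unfolding exp_mean_def
    by (subst nn_integral_density) (auto simp: ennreal_mult' intro!: nn_integral_cong)
  then show ?thesis
    using assms by (subst (asm) nn_integral_erlang_ith_moment) simp_all
qed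

text \<open>Abstracts from the geometry: positions, powers and path-loss exponents are replaced by
  the positive mean SNRs that they produce.\<close>

locale rsu_access =
  fixes K :: nat and p0 tauR tauC delta tau_d :: real and gD g1 g2 :: "nat \<Rightarrow> real"
  assumes K: "K \<ge> 1" and p0: "0 < p0" "p0 < 1"
    and tau: "tauR > 0" "tauC > 0" "delta > 0" "tau_d > tauR + tauC"
    and gD: "\<And>i. i \<in> {1..K} \<Longrightarrow> gD i > 0"
    and g1: "\<And>i. i \<in> {1..K} \<Longrightarrow> g1 i > 0"
    and g2: "\<And>i. i \<in> {1..K} \<Longrightarrow> g2 i > 0"
begin

abbreviation "tau1 \<equiv> tauR + tauC"
abbreviation "SM \<equiv> stage_M p0 K gD g1 g2"
abbreviation "OM \<equiv> Omega p0 K gD g1 g2"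
abbreviation "tw \<equiv> t_w tauR tauC delta"
abbreviation "mean_tw \<equiv> tau_o p0 K tauR tauC delta"

definition slotsM :: "(nat \<Rightarrow> slot) measure" where
  "slotsM = PiM UNIV (\<lambda>_. measure_pmf (slot_pmf p0 K))"
definition winM :: "nat measure" where "winM = measure_pmf (pmf_of_set {1..K})"
definition snrM :: "(nat \<Rightarrow> real) \<Rightarrow> (nat \<Rightarrow> real) measure" where
  "snrM m = PiM {1..K} (\<lambda>i. exp_mean (m i))"

lemma SM_eq: "SM = slotsM \<Otimes>\<^sub>M winM \<Otimes>\<^sub>M snrM gD \<Otimes>\<^sub>M snrM g1 \<Otimes>\<^sub>M snrM g2"
  by (simp add: stage_M_def slotsM_def winM_def snrM_def)

text \<open>Outside of the index set, the components are constantly undefined, hence measurable as well.\<close>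

lemma measurable_snrM_component: "(\<lambda>g. g i) \<in> borel_measurable (snrM m)"
proof (cases "i \<in> {1..K}")
  case True
  then have "(\<lambda>g. g i) \<in> snrM m \<rightarrow>\<^sub>M exp_mean (m i)"
    unfolding snrM_def by (rule measurable_component_singleton)
  then show ?thesis
    by (subst (asm) measurable_cong_sets[OF refl sets_exp_mean])
next
  case False
  have "g i = undefined" if "g \<in> space (snrM m)" for g
    using that False unfolding snrM_def space_PiM by (rule PiE_arb)
  from measurable_cong[THEN iffD2, OF this borel_measurable_const] show ?thesis .
qed

lemma prob_space_snrM: "(\<And>i. i \<in> {1..K} \<Longrightarrow> m i > 0) \<Longrightarrow> prob_space (snrM m)"
  unfolding snrM_def by (intro prob_space_PiM prob_space_exp_mean)

sublocale slots: prob_space slotsM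
  unfolding slotsM_def by (intro prob_space_PiM prob_space_measure_pmf)
sublocale win: prob_space winM
  unfolding winM_def by (rule prob_space_measure_pmf)
sublocale snrD: prob_space "snrM gD" by (intro prob_space_snrM gD)
sublocale snr1: prob_space "snrM g1" by (intro prob_space_snrM g1)
sublocale snr2: prob_space "snrM g2" by (intro prob_space_snrM g2)
sublocale relay: pair_prob_space "snrM g1" "snrM g2" ..
sublocale obs2: pair_prob_space "snrM gD" "snrM g1 \<Otimes>\<^sub>M snrM g2" ..
sublocale obs1: pair_prob_space winM "snrM gD \<Otimes>\<^sub>M snrM g1 \<Otimes>\<^sub>M snrM g2" ..
sublocale stage: pair_prob_space slotsM "winM \<Otimes>\<^sub>M snrM gD \<Otimes>\<^sub>M snrM g1 \<Otimes>\<^sub>M snrM g2" ..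

lemma prob_space_SM: "prob_space SM"
  unfolding SM_eq by (rule stage.P.prob_space_axioms)

lemma sets_winM[measurable_cong]: "sets winM = sets (count_space UNIV)"
  by (simp add: winM_def)

lemma sets_slotsM[measurable_cong]: "sets slotsM = sets (PiM UNIV (\<lambda>_. count_space UNIV))"
  unfolding slotsM_def by (intro sets_PiM_cong) auto

lemma AE_winM: "AE w in winM. w \<in> {1..K}"
  using K unfolding winM_def by (subst AE_measure_pmf_iff) auto

text \<open>Fubini in the order of the decisions: with slots, winner and direct SNRs fixed, the
  first observation and every decision based on it are constant in the innermost integral.\<close>

lemma nn_integral_SM:
  assumes [measurable]: "f \<in> borel_measurable SM"
  shows "(\<integral>\<^sup>+x. f x \<partial>SM) =
    (\<integral>\<^sup>+s. \<integral>\<^sup>+w. \<integral>\<^sup>+g. \<integral>\<^sup>+z. f (s, w, g, z) \<partial>(snrM g1 \<Otimes>\<^sub>M snrM g2) \<partial>snrM gD \<partial>winM \<partial>slotsM)"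
proof -
  have [measurable]: "f \<in> borel_measurable (slotsM \<Otimes>\<^sub>M winM \<Otimes>\<^sub>M snrM gD \<Otimes>\<^sub>M snrM g1 \<Otimes>\<^sub>M snrM g2)"
    using assms by (simp add: SM_eq)
  have "(\<integral>\<^sup>+x. f x \<partial>SM) = (\<integral>\<^sup>+s. \<integral>\<^sup>+y. f (s, y) \<partial>(winM \<Otimes>\<^sub>M snrM gD \<Otimes>\<^sub>M snrM g1 \<Otimes>\<^sub>M snrM g2) \<partial>slotsM)"
    unfolding SM_eq by (rule obs1.P.nn_integral_fst[symmetric]) measurable
  also have "\<dots> = (\<integral>\<^sup>+s. \<integral>\<^sup>+w. \<integral>\<^sup>+y. f (s, w, y) \<partial>(snrM gD \<Otimes>\<^sub>M snrM g1 \<Otimes>\<^sub>M snrM g2) \<partial>winM \<partial>slotsM)"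
    by (intro nn_integral_cong obs2.P.nn_integral_fst[symmetric, of "\<lambda>y. f (_, y)"]) measurable
  also have "\<dots> = (\<integral>\<^sup>+s. \<integral>\<^sup>+w. \<integral>\<^sup>+g. \<integral>\<^sup>+z. f (s, w, g, z) \<partial>(snrM g1 \<Otimes>\<^sub>M snrM g2) \<partial>snrM gD \<partial>winM \<partial>slotsM)"
    by (intro nn_integral_cong relay.P.nn_integral_fst[symmetric, of "\<lambda>y. f (_, _, y)"]) measurable
  finally show ?thesis .
qed

lemma AE_SM:
  assumes "AE x in SM. P x"
  shows "AE s in slotsM. AE w in winM. AE g in snrM gD. AE z in snrM g1 \<Otimes>\<^sub>M snrM g2. P (s, w, g, z)"
  using stage.AE_pair[OF assms[unfolded SM_eq]]
proof (rule eventually_mono)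
  fix s assume "AE y in winM \<Otimes>\<^sub>M snrM gD \<Otimes>\<^sub>M snrM g1 \<Otimes>\<^sub>M snrM g2. P (s, y)"
  from obs1.AE_pair[OF this]
  show "AE w in winM. AE g in snrM gD. AE z in snrM g1 \<Otimes>\<^sub>M snrM g2. P (s, w, g, z)"
    by (rule eventually_mono) (rule obs2.AE_pair)
qed

section \<open>Slot outcomes and the mean contention time\<close>

lemma nn_integral_slot_dur:
  defines "q \<equiv> real K * p0 * (1 - p0) ^ (K - 1)"
  shows "(\<integral>\<^sup>+s. ennreal (slot_dur tauR tauC delta s) \<partial>measure_pmf (slot_pmf p0 K)) = ennreal (q * mean_tw)"
    and "emeasure (measure_pmf (slot_pmf p0 K)) {Succ} = ennreal q"
    and "q > 0"
proof -
  let ?a = "(1 - p0) ^ K"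
  have a: "0 < ?a" "?a < 1"
    using p0 K by (auto simp: power_less_one_iff)
  show q: "q > 0"
    using p0 K by (auto simp: q_def)
  have aq: "?a + q \<le> 1"
    using success_plus_idle_le_1[of p0 K] p0 by (simp add: q_def)
  \<comment> \<open>The probability of success given that the slot is not idle, which is the
    parameter of the second draw in \<open>slot_pmf\<close>.\<close>
  define c where "c = q / (1 - ?a)"
  have c: "0 \<le> c" "c \<le> 1" and q_eq: "q = (1 - ?a) * c"
    using a q aq by (auto simp: c_def divide_simps)
  have I: "(\<integral>\<^sup>+s. ennreal (f s) \<partial>measure_pmf (slot_pmf p0 K)) =
      ennreal (?a * f Idle + q * f Succ + (1 - ?a - q) * f Coll)" if "\<And>s. f s \<ge> 0" for f
  proof -
    have "(\<integral>\<^sup>+s. ennreal (f s) \<partial>measure_pmf (slot_pmf p0 K)) =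
      ennreal (?a * f Idle + (1 - ?a) * (c * f Succ + (1 - c) * f Coll))"
      unfolding slot_pmf_def q_def[symmetric] c_def[symmetric] using a c that
      by (simp add: nn_integral_bernoulli_pmf nn_integral_return_pmf nn_integral_map_pmf
            less_imp_le mult.commute flip: ennreal_mult ennreal_plus)
    also have "?a * f Idle + (1 - ?a) * (c * f Succ + (1 - c) * f Coll) =
        ?a * f Idle + q * f Succ + (1 - ?a - q) * f Coll"
      by (simp add: q_eq algebra_simps)
    finally show ?thesis .
  qed
  have "?a * delta + q * tau1 + (1 - ?a - q) * tauR = q * mean_tw"
    unfolding tau_o_def Let_def q_def[symmetric] using q by (simp add: field_simps)
  then show "(\<integral>\<^sup>+s. ennreal (slot_dur tauR tauC delta s) \<partial>measure_pmf (slot_pmf p0 K)) = ennreal (q * mean_tw)"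
    using tau by (subst I) (auto simp: slot_dur_def split: slot.split)
  have "(\<integral>\<^sup>+s. ennreal (of_bool (s = Succ)) \<partial>measure_pmf (slot_pmf p0 K)) =
      (\<integral>\<^sup>+s. indicator {Succ} s \<partial>measure_pmf (slot_pmf p0 K))"
    by (intro nn_integral_cong) (simp add: indicator_def)
  then show "emeasure (measure_pmf (slot_pmf p0 K)) {Succ} = ennreal q"
    by (subst (asm) I) auto
qed

lemma tw_measurable[measurable]: "tw \<in> borel_measurable SM"
proof -
  let ?S = "PiM UNIV (\<lambda>_. count_space UNIV) :: (nat \<Rightarrow> slot) measure"
  have L: "(\<lambda>s. LEAST j. s j = Succ) \<in> ?S \<rightarrow>\<^sub>M count_space UNIV"
    by measurable
  have "(\<lambda>s. \<Sum>j<n. slot_dur tauR tauC delta (s j)) \<in> borel_measurable ?S" for n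
  proof (rule borel_measurable_sum)
    fix j
    show "(\<lambda>s. slot_dur tauR tauC delta (s j)) \<in> borel_measurable ?S"
      by (rule measurable_compose[where N="count_space UNIV"]) auto
  qed
  from measurable_compose_countable[OF this L]
  have *: "(\<lambda>s. \<Sum>j<(LEAST j. s j = Succ). slot_dur tauR tauC delta (s j)) \<in> borel_measurable ?S" .
  have "fst \<in> SM \<rightarrow>\<^sub>M slotsM"
    unfolding SM_eq by (rule measurable_fst)
  then have "fst \<in> SM \<rightarrow>\<^sub>M ?S"
    by (simp cong: measurable_cong_sets add: sets_slotsM)
  from measurable_compose[OF this *] show ?thesis
    unfolding t_w_def[abs_def] Let_def st_slots_def by (rule borel_measurable_add[OF _ borel_measurable_const])
qed

lemma tw_ge: "tw x \<ge> tau1"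
  using tau unfolding t_w_def Let_def
  by (auto simp: slot_dur_def intro!: sum_nonneg split: slot.split)

lemma tw_pos: "tw x > 0"
  using tw_ge[of x] tau by simp

lemma tw_fst: "tw (s, y) = tw (s, y')"
  by (simp add: t_w_def st_slots_def)

text \<open>Wald's identity over the slots of one contention, stopped at the first success: mean
  slot duration divided by the success probability.\<close>

lemma nn_integral_tw: "(\<integral>\<^sup>+s. ennreal (tw (s, y)) \<partial>slotsM) = ennreal mean_tw"
proof -
  let ?S = "measure_pmf (slot_pmf p0 K)"
  let ?q = "real K * p0 * (1 - p0) ^ (K - 1)"
  note S = nn_integral_slot_dur
  have pos: "emeasure ?S {s \<in> space ?S. s = Succ} \<noteq> 0"
  proof -
    have "{s \<in> space ?S. s = Succ} = {Succ}" by auto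
    moreover have "ennreal ?q \<noteq> 0" using S(3) by (simp only: ennreal_eq_0_iff not_le)
    ultimately show ?thesis by (simp only: S(2) not_False_eq_True)
  qed
  have "AE s in slotsM. \<exists>k. s k = Succ"
    unfolding slotsM_def by (rule AE_PiM_hits[OF prob_space_measure_pmf _ pos]) simp
  then have "AE s in slotsM. ennreal (tw (s, y)) =
      (\<Sum>n\<le>(LEAST k. s k = Succ). ennreal (slot_dur tauR tauC delta (s n)))"
  proof eventually_elim
    case (elim s)
    then have "s (LEAST k. s k = Succ) = Succ" by (rule LeastI_ex)
    then have "tw (s, y) = (\<Sum>n\<le>(LEAST k. s k = Succ). slot_dur tauR tauC delta (s n))"
      by (simp add: t_w_def Let_def st_slots_def lessThan_Suc_atMost[symmetric])
    then show ?case
      using tau by (simp add: slot_dur_def split: slot.split)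
  qed
  then have "(\<integral>\<^sup>+s. ennreal (tw (s, y)) \<partial>slotsM) =
      (\<integral>\<^sup>+s. (\<Sum>n\<le>(LEAST k. s k = Succ). ennreal (slot_dur tauR tauC delta (s n))) \<partial>slotsM)"
    by (rule nn_integral_cong_AE)
  also have "\<dots> = ennreal (?q * mean_tw) / ennreal ?q"
    unfolding slotsM_def
    by (subst nn_integral_PiM_sum_until_hit[OF prob_space_measure_pmf _ pos]) (simp_all add: S(1,2))
  also have "\<dots> = ennreal mean_tw"
  \<comment> \<open>The sign of \<open>mean_tw\<close> is derived only afterwards, from this very
    equation; a negative value would turn both sides into 0 under \<open>ennreal\<close>.\<close>
  proof (cases "mean_tw \<ge> 0")
    case True
    have "ennreal (?q * mean_tw) / ennreal ?q = ennreal (?q * mean_tw / ?q)"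
      by (rule divide_ennreal[OF mult_nonneg_nonneg[OF less_imp_le[OF S(3)] True] S(3)])
    also have "?q * mean_tw / ?q = mean_tw"
      by (rule nonzero_mult_div_cancel_left[OF less_imp_neq[OF S(3), symmetric]])
    finally show ?thesis .
  next
    case False
    with S(3) have "?q * mean_tw \<le> 0" by (intro mult_nonneg_nonpos) auto
    with False show ?thesis by (simp only: ennreal_neg) (simp add: ennreal_neg)
  qed
  finally show ?thesis .
qed

text \<open>Each contention lasts at least as long as its successful slot, of length
  \<open>tau1\<close>, and hence so does its mean. This avoids a discussion of the terms of the
  formula.\<close>

lemma mean_tw_pos: "mean_tw > 0"
proof -
  have "ennreal tau1 = (\<integral>\<^sup>+s. ennreal tau1 \<partial>slotsM)"
    by (simp add: slots.emeasure_space_1)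
  also have "\<dots> \<le> (\<integral>\<^sup>+s. ennreal (tw (s, undefined)) \<partial>slotsM)"
    by (intro nn_integral_mono ennreal_leI tw_ge)
  also have "\<dots> = ennreal mean_tw" by (rule nn_integral_tw)
  finally have "ennreal tau1 \<le> ennreal mean_tw" .
  then show ?thesis using tau by (simp add: ennreal_le_iff2 del: ennreal_plus)
qed

end

subsection \<open>The value of probing\<close>

definition relay_rate :: "real \<Rightarrow> real \<times> real \<Rightarrow> real" where
  "relay_rate g z = max (log 2 (1 + g)) (1/2 * log 2 (1 + g_relay g (fst z) (snd z)))"

lemma relay_rate_measurable[measurable]:
  "case_prod relay_rate \<in> borel_measurable (borel \<Otimes>\<^sub>M borel \<Otimes>\<^sub>M borel)"
  unfolding relay_rate_def g_relay_def split_beta' by measurable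

lemma log2_one_plus_bounds:
  fixes x :: real
  assumes "0 \<le> x"
  shows "0 \<le> log 2 (1 + x)" "log 2 (1 + x) \<le> x / ln 2"
  using assms ln_add_one_self_le_self[of x] by (auto simp: log_def divide_right_mono)

text \<open>The relay contributes \<open>a * b / (a + b + 1) \<le> a\<close>, and
  \<open>log 2 (1 + x) \<le> x / ln 2\<close>. The bound is linear in the SNRs, which reduces
  integrability to the finite mean of an exponential variable.\<close>

lemma relay_rate_bounds:
  assumes "0 \<le> g" "0 \<le> fst z" "0 \<le> snd z"
  shows "0 \<le> relay_rate g z" "relay_rate g z \<le> (g + fst z) / ln 2"
proof -
  let ?a = "fst z" and ?b = "snd z"
  have "?a * ?b / (?a + ?b + 1) \<le> ?a"
    using assms by (simp add: divide_simps) (simp add: algebra_simps)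
  then have r: "0 \<le> g_relay g ?a ?b" "g_relay g ?a ?b \<le> g + ?a"
    using assms by (auto simp: g_relay_def)
  have "log 2 (1 + g) \<le> (g + ?a) / ln 2"
    using log2_one_plus_bounds(2)[of g] assms divide_right_mono[of g "g + ?a" "ln 2"] by simp
  moreover have "log 2 (1 + g_relay g ?a ?b) \<le> (g + ?a) / ln 2"
    using log2_one_plus_bounds(2)[OF r(1)] r divide_right_mono[of _ "g + ?a" "ln 2"] by force
  ultimately show "relay_rate g z \<le> (g + ?a) / ln 2"
    using log2_one_plus_bounds(1)[OF r(1)] unfolding relay_rate_def by linarith
  show "0 \<le> relay_rate g z"
    using log2_one_plus_bounds(1)[OF assms(1)] by (simp add: relay_rate_def)
qed

lemma AE_exp_mean_pair_nonneg:
  assumes "0 < m1" "0 < m2"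
  shows "AE z in exp_mean m1 \<Otimes>\<^sub>M exp_mean m2. 0 \<le> fst z \<and> 0 \<le> snd z"
proof -
  interpret A: prob_space "exp_mean m1" using assms by (intro prob_space_exp_mean)
  interpret B: prob_space "exp_mean m2" using assms by (intro prob_space_exp_mean)
  interpret AB: pair_prob_space "exp_mean m1" "exp_mean m2" ..
  show ?thesis
    using AE_exp_mean_nonneg[of m1] AE_exp_mean_nonneg[of m2]
    by (intro AB.AE_pair_measure) (auto elim: eventually_mono)
qed

lemma integrable_fst_exp_mean_pair:
  assumes "0 < m1" "0 < m2"
  shows "integrable (exp_mean m1 \<Otimes>\<^sub>M exp_mean m2) fst"
    and "(\<integral>z. fst z \<partial>(exp_mean m1 \<Otimes>\<^sub>M exp_mean m2)) = m1"
proof -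
  interpret A: prob_space "exp_mean m1" using assms by (intro prob_space_exp_mean)
  interpret B: prob_space "exp_mean m2" using assms by (intro prob_space_exp_mean)
  have idm: "(\<lambda>x. x) \<in> borel_measurable (exp_mean m1)"
    by (rule measurable_ident_sets) (rule sets_exp_mean)
  have "has_bochner_integral (exp_mean m1) (\<lambda>x. x) m1"
    by (rule has_bochner_integral_nn_integral[OF idm AE_exp_mean_nonneg _ nn_integral_exp_mean])
       (use assms in simp_all)
  then have *: "integrable (exp_mean m1) (\<lambda>x. x)" "(\<integral>x. x \<partial>exp_mean m1) = m1"
    by (auto simp: has_bochner_integral_iff)
  have d: "distr (exp_mean m1 \<Otimes>\<^sub>M exp_mean m2) (exp_mean m1) fst = exp_mean m1"
    by (rule B.distr_pair_fst)
  have "integrable (distr (exp_mean m1 \<Otimes>\<^sub>M exp_mean m2) (exp_mean m1) fst) (\<lambda>x. x)"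
    unfolding d by (rule *)
  then show "integrable (exp_mean m1 \<Otimes>\<^sub>M exp_mean m2) fst"
    by (simp only: integrable_distr_eq[OF measurable_fst idm])
  have "(\<integral>x. x \<partial>distr (exp_mean m1 \<Otimes>\<^sub>M exp_mean m2) (exp_mean m1) fst) = m1"
    unfolding d by (rule *)
  then show "(\<integral>z. fst z \<partial>(exp_mean m1 \<Otimes>\<^sub>M exp_mean m2)) = m1"
    by (simp only: integral_distr[OF measurable_fst idm])
qed

context rsu_access
begin

text \<open>Net gain of a probe at time price \<open>lam\<close>: a transmission is charged
  \<open>tau_d\<close> in total, the probe included, while re-contending forfeits the time
  \<open>tau1\<close> just spent.\<close>

definition pay :: "real \<Rightarrow> real \<Rightarrow> real \<times> real \<Rightarrow> real" where
  "pay lam g z = max ((tau_d - tau1) * relay_rate g z - lam * tau_d) (- lam * tau1)"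

abbreviation "exp2 i \<equiv> exp_mean (g1 i) \<Otimes>\<^sub>M exp_mean (g2 i)"
abbreviation "Wf i g lam \<equiv> W tau_d tau1 g1 g2 i g lam"

lemma Wf_eq: "Wf i g lam = (\<integral>z. pay lam g z \<partial>exp2 i)"
  by (simp add: W_def pay_def relay_rate_def)

lemma pay_measurable[measurable]:
  "(\<lambda>p. pay lam (fst p) (snd p)) \<in> borel_measurable (borel \<Otimes>\<^sub>M borel \<Otimes>\<^sub>M borel)"
  using relay_rate_measurable unfolding pay_def split_beta' by measurable

lemma pay_measurable2[measurable]: "pay lam g \<in> borel_measurable (borel \<Otimes>\<^sub>M borel)"
  using measurable_compose[OF measurable_Pair1' pay_measurable[of lam], of g] by simp

lemma Wf_measurable[measurable]: "(\<lambda>g. Wf i g lam) \<in> borel_measurable borel"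
proof -
  interpret A: sigma_finite_measure "exp_mean (g1 i)" by (rule sigma_finite_exp_mean)
  interpret B: sigma_finite_measure "exp_mean (g2 i)" by (rule sigma_finite_exp_mean)
  interpret AB: pair_sigma_finite "exp_mean (g1 i)" "exp_mean (g2 i)" ..
  have "sets (borel \<Otimes>\<^sub>M exp2 i) = sets (borel \<Otimes>\<^sub>M borel \<Otimes>\<^sub>M borel)"
    by (intro sets_pair_measure_cong sets_exp_mean refl)
  then have "case_prod (pay lam) \<in> borel_measurable (borel \<Otimes>\<^sub>M exp2 i)"
    using pay_measurable unfolding split_beta' by (subst measurable_cong_sets[OF _ refl]) auto
  then show ?thesis
    unfolding Wf_eq by (rule AB.P.borel_measurable_lebesgue_integral)
qed

lemma pay_measurable_exp2[measurable]: "pay lam g \<in> borel_measurable (exp2 i)"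
proof -
  have "sets (exp2 i) = sets (borel \<Otimes>\<^sub>M borel)"
    by (intro sets_pair_measure_cong sets_exp_mean refl)
  then show ?thesis using pay_measurable2 by (subst measurable_cong_sets[OF _ refl]) auto
qed

lemma pay_snrM_measurable[measurable]:
  "(\<lambda>z. pay lam g (fst z i, snd z i)) \<in> borel_measurable (snrM m \<Otimes>\<^sub>M snrM m')"
  by (rule measurable_compose[OF _ pay_measurable2], rule measurable_Pair)
     (rule measurable_compose[OF measurable_fst measurable_snrM_component]
       measurable_compose[OF measurable_snd measurable_snrM_component])+

lemma pay_ge: "- (lam * tau1) \<le> pay lam g z"
  by (simp add: pay_def)

lemma pay_le:
  assumes "0 \<le> g" "0 \<le> fst z" "0 \<le> snd z" "0 \<le> lam"
  shows "pay lam g z \<le> tau_d * ((g + fst z) / ln 2)"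
proof -
  have "(tau_d - tau1) * relay_rate g z \<le> tau_d * ((g + fst z) / ln 2)"
    using relay_rate_bounds[OF assms(1-3)] tau by (intro mult_mono) auto
  moreover have "0 \<le> lam * tau_d" "- lam * tau1 \<le> 0" "0 \<le> tau_d * ((g + fst z) / ln 2)"
    using assms tau by (auto intro!: mult_nonneg_nonneg mult_nonpos_nonneg)
  ultimately show ?thesis by (simp add: pay_def)
qed

lemma integrable_pay:
  assumes i: "i \<in> {1..K}" and g: "0 \<le> g" and lam: "0 \<le> lam"
  shows "integrable (exp2 i) (pay lam g)" and "Wf i g lam \<le> tau_d * ((g + g1 i) / ln 2)"
proof -
  note gp = g1[OF i] g2[OF i]
  interpret A: prob_space "exp_mean (g1 i)" using gp by (intro prob_space_exp_mean)
  interpret B: prob_space "exp_mean (g2 i)" using gp by (intro prob_space_exp_mean)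
  interpret AB: pair_prob_space "exp_mean (g1 i)" "exp_mean (g2 i)" ..
  have I: "integrable (exp2 i) (\<lambda>z. tau_d * ((g + fst z) / ln 2))"
    using integrable_fst_exp_mean_pair(1)[OF gp] by auto
  have AE: "AE z in exp2 i. pay lam g z \<le> tau_d * ((g + fst z) / ln 2)"
    using AE_exp_mean_pair_nonneg[OF gp] by eventually_elim (use pay_le g lam in auto)
  show Ip: "integrable (exp2 i) (pay lam g)"
  proof (rule Bochner_Integration.integrable_bound)
    show "integrable (exp2 i) (\<lambda>z. tau_d * ((g + fst z) / ln 2) + lam * tau1)"
      using I by auto
    have l: "0 \<le> lam * tau1" using lam tau by auto
    show "AE z in exp2 i. norm (pay lam g z) \<le> norm (tau_d * ((g + fst z) / ln 2) + lam * tau1)"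
      using AE AE_exp_mean_pair_nonneg[OF gp]
    proof eventually_elim
      case (elim z)
      have "0 \<le> tau_d * ((g + fst z) / ln 2)" using elim g tau by auto
      then show ?case using elim pay_ge[of lam g z] l by auto
    qed
  qed simp
  have "Wf i g lam \<le> (\<integral>z. tau_d * ((g + fst z) / ln 2) \<partial>exp2 i)"
    unfolding Wf_eq by (intro integral_mono_AE Ip I AE)
  also have "\<dots> = tau_d * ((g + g1 i) / ln 2)"
    using integrable_fst_exp_mean_pair[OF gp] by (simp add: AB.P.prob_space)
  finally show "Wf i g lam \<le> tau_d * ((g + g1 i) / ln 2)" .
qed

text \<open>The two branches of \<open>pay\<close> decrease in \<open>lam\<close> at rates
  \<open>tau_d\<close> and \<open>tau1\<close>, and \<open>tau1 < tau_d\<close>. Maximum and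
  expectation preserve monotonicity and the larger rate.\<close>

lemma Wf_antimono_lipschitz:
  assumes "i \<in> {1..K}" "0 \<le> g" "0 \<le> lam" "lam \<le> mu"
  shows "Wf i g mu \<le> Wf i g lam" "Wf i g lam \<le> Wf i g mu + (mu - lam) * tau_d"
proof -
  note gp = g1[OF assms(1)] g2[OF assms(1)]
  interpret A: prob_space "exp_mean (g1 i)" using gp by (intro prob_space_exp_mean)
  interpret B: prob_space "exp_mean (g2 i)" using gp by (intro prob_space_exp_mean)
  interpret AB: pair_prob_space "exp_mean (g1 i)" "exp_mean (g2 i)" ..
  have I: "integrable (exp2 i) (pay lam g)" "integrable (exp2 i) (pay mu g)"
    using assms by (auto intro!: integrable_pay)
  have t: "lam * tau_d \<le> mu * tau_d" "lam * tau1 \<le> mu * tau1" "(mu - lam) * tau1 \<le> (mu - lam) * tau_d"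
    using assms tau by (auto intro!: mult_right_mono mult_left_mono simp del: distrib_left)
  show "Wf i g mu \<le> Wf i g lam"
    unfolding Wf_eq using I t by (intro integral_mono) (auto simp: pay_def)
  have "Wf i g lam \<le> (\<integral>z. pay mu g z + (mu - lam) * tau_d \<partial>exp2 i)"
    unfolding Wf_eq
  proof (intro integral_mono I)
    show "pay lam g z \<le> pay mu g z + (mu - lam) * tau_d" for z
      using t unfolding pay_def left_diff_distrib[of mu lam] by linarith
  qed (use I in auto)
  also have "\<dots> = Wf i g mu + (mu - lam) * tau_d"
    using I by (simp add: Wf_eq AB.P.prob_space)
  finally show "Wf i g lam \<le> Wf i g mu + (mu - lam) * tau_d" .
qed

lemma nn_integral_snr_pair:
  assumes i: "i \<in> {1..K}" and [measurable]: "f \<in> borel_measurable (borel \<Otimes>\<^sub>M borel)"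
  shows "(\<integral>\<^sup>+z. f (fst z i, snd z i) \<partial>(snrM g1 \<Otimes>\<^sub>M snrM g2)) = (\<integral>\<^sup>+z. f z \<partial>exp2 i)"
proof -
  have d: "distr (snrM g1) (exp_mean (g1 i)) (\<lambda>x. x i) = exp_mean (g1 i)"
    "distr (snrM g2) (exp_mean (g2 i)) (\<lambda>x. x i) = exp_mean (g2 i)"
    unfolding snrM_def using i g1 g2
    by (auto intro!: distr_PiM_component[where M="\<lambda>i. exp_mean (_ i)"] prob_space_exp_mean)
  have m: "(\<lambda>x. x i) \<in> snrM g1 \<rightarrow>\<^sub>M exp_mean (g1 i)" "(\<lambda>x. x i) \<in> snrM g2 \<rightarrow>\<^sub>M exp_mean (g2 i)"
    unfolding snrM_def using i by (auto intro: measurable_component_singleton)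
  have "exp2 i = distr (snrM g1 \<Otimes>\<^sub>M snrM g2) (exp2 i) (\<lambda>(x, y). (x i, y i))"
    using pair_measure_distr[OF m] sigma_finite_exp_mean by (simp add: d)
  then have "(\<integral>\<^sup>+z. f z \<partial>exp2 i) = (\<integral>\<^sup>+z. f z \<partial>distr (snrM g1 \<Otimes>\<^sub>M snrM g2) (exp2 i) (\<lambda>(x, y). (x i, y i)))"
    by simp
  also have "\<dots> = (\<integral>\<^sup>+z. f (fst z i, snd z i) \<partial>(snrM g1 \<Otimes>\<^sub>M snrM g2))"
    by (subst nn_integral_distr)
       (auto simp: split_beta' intro!: measurable_Pair measurable_compose[OF measurable_fst m(1)]
         measurable_compose[OF measurable_snd m(2)])
  finally show ?thesis ..
qed

text \<open>The shift by \<open>lam * tau1\<close> makes the integrand nonnegative, which carries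
  the Bochner integral \<open>W\<close> over to \<open>ennreal\<close>.\<close>

lemma nn_integral_pay:
  assumes "i \<in> {1..K}" "0 \<le> g" "0 \<le> lam"
  shows "(\<integral>\<^sup>+z. ennreal (pay lam g (fst z i, snd z i) + lam * tau1) \<partial>(snrM g1 \<Otimes>\<^sub>M snrM g2))
    = ennreal (Wf i g lam + lam * tau1)"
proof -
  note gp = g1[OF assms(1)] g2[OF assms(1)]
  interpret A: prob_space "exp_mean (g1 i)" using gp by (intro prob_space_exp_mean)
  interpret B: prob_space "exp_mean (g2 i)" using gp by (intro prob_space_exp_mean)
  interpret AB: pair_prob_space "exp_mean (g1 i)" "exp_mean (g2 i)" ..
  have "(\<integral>\<^sup>+z. ennreal (pay lam g z + lam * tau1) \<partial>exp2 i) = ennreal (\<integral>z. pay lam g z + lam * tau1 \<partial>exp2 i)"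
  proof (intro nn_integral_eq_integral AE_I2)
    show "0 \<le> pay lam g z + lam * tau1" for z using pay_ge[of lam g z] by linarith
  qed (use integrable_pay(1)[OF assms] in auto)
  also have "(\<integral>z. pay lam g z + lam * tau1 \<partial>exp2 i) = Wf i g lam + lam * tau1"
    using integrable_pay(1)[OF assms] by (simp add: Wf_eq AB.P.prob_space)
  finally show ?thesis
    by (subst nn_integral_snr_pair[OF assms(1), of "\<lambda>z. ennreal (pay lam g z + lam * tau1)"]) simp_all
qed

subsection \<open>The fixed-point equation\<close>

abbreviation "gw x \<equiv> st_g x (st_w x)"
abbreviation "zw x \<equiv> (st_g1 x (st_w x), st_g2 x (st_w x))"

lemma st_simps:
  "st_w (s, w, g, z) = w" "st_g (s, w, g, z) = g" "st_g1 (s, w, g, z) = fst z" "st_g2 (s, w, g, z) = snd z"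
  by (simp_all add: st_w_def st_g_def st_g1_def st_g2_def)

text \<open>The SNRs are read off at a random index. The winner takes countably many values, so
  measurability for each fixed index is enough.\<close>

lemma measurable_winner_obs:
  assumes "\<And>i. (\<lambda>p. F i (fst p) (snd p)) \<in> borel \<Otimes>\<^sub>M borel \<Otimes>\<^sub>M borel \<rightarrow>\<^sub>M N"
  shows "(\<lambda>x. F (st_w x) (gw x) (zw x)) \<in> SM \<rightarrow>\<^sub>M N"
proof -
  have w: "st_w \<in> SM \<rightarrow>\<^sub>M count_space UNIV"
    unfolding st_w_def[abs_def] SM_eq by measurable
  have [measurable]: "st_g \<in> SM \<rightarrow>\<^sub>M snrM gD" "st_g1 \<in> SM \<rightarrow>\<^sub>M snrM g1" "st_g2 \<in> SM \<rightarrow>\<^sub>M snrM g2"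
    unfolding st_g_def[abs_def] st_g1_def[abs_def] st_g2_def[abs_def] SM_eq by measurable
  have "(\<lambda>x. F i (st_g x i) (st_g1 x i, st_g2 x i)) \<in> SM \<rightarrow>\<^sub>M N" for i
  proof -
    have "(\<lambda>x. (st_g x i, st_g1 x i, st_g2 x i)) \<in> SM \<rightarrow>\<^sub>M borel \<Otimes>\<^sub>M borel \<Otimes>\<^sub>M borel"
      by (intro measurable_Pair measurable_compose[OF _ measurable_snrM_component]) measurable
    from measurable_compose[OF this assms[of i]] show ?thesis by simp
  qed
  from measurable_compose_countable[OF this w] show ?thesis .
qed

text \<open>The best gain of a stage given its first observation, before the contention is charged;
  re-contending has value 0, and probing enters through its conditional mean.\<close>

definition psi :: "real \<Rightarrow> nat \<Rightarrow> real \<Rightarrow> real" where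
  "psi lam i g = max (max (tau_d * log 2 (1 + g) - lam * tau_d) 0) (Wf i g lam)"

definition Phi :: "real \<Rightarrow> real" where
  "Phi lam = (\<integral>x. psi lam (st_w x) (gw x) \<partial>SM)"

lemma psi_measurable[measurable]: "psi lam i \<in> borel_measurable borel"
  unfolding psi_def[abs_def] by measurable

lemma psi_SM_measurable[measurable]: "(\<lambda>x. psi lam (st_w x) (gw x)) \<in> borel_measurable SM"
  by (rule measurable_winner_obs) measurable

lemma psi_nonneg: "0 \<le> psi lam i g"
  by (simp add: psi_def)

lemma psi_le:
  assumes "i \<in> {1..K}" "0 \<le> g" "0 \<le> lam"
  shows "psi lam i g \<le> tau_d * ((g + g1 i) / ln 2)"
proof -
  have "tau_d * log 2 (1 + g) \<le> tau_d * ((g + g1 i) / ln 2)"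
    using tau log2_one_plus_bounds(2)[OF assms(2)] g1[OF assms(1)]
      divide_right_mono[of g "g + g1 i" "ln 2"] by (intro mult_left_mono) auto
  moreover have "0 \<le> lam * tau_d" "0 \<le> tau_d * ((g + g1 i) / ln 2)"
    using assms tau g1[OF assms(1)] by auto
  ultimately show ?thesis
    using integrable_pay(2)[OF assms] by (simp add: psi_def)
qed

lemma AE_snrM_nonneg: "i \<in> {1..K} \<Longrightarrow> (\<And>i. i \<in> {1..K} \<Longrightarrow> m i > 0) \<Longrightarrow> AE g in snrM m. 0 \<le> g i"
  unfolding snrM_def
  by (rule AE_PiM_component[where P="\<lambda>x. 0 \<le> x"]) (auto intro: prob_space_exp_mean AE_exp_mean_nonneg)

lemma nn_integral_snrM_component:
  assumes "i \<in> {1..K}" "\<And>i. i \<in> {1..K} \<Longrightarrow> m i > 0"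
  shows "(\<integral>\<^sup>+g. ennreal (g i) \<partial>snrM m) = ennreal (m i)"
proof -
  have m: "(\<lambda>g. g i) \<in> snrM m \<rightarrow>\<^sub>M exp_mean (m i)"
    unfolding snrM_def using assms(1) by (rule measurable_component_singleton)
  have e: "ennreal \<in> borel_measurable (exp_mean (m i))"
    by (subst measurable_cong_sets[OF sets_exp_mean refl]) (rule measurable_ennreal)
  have "(\<integral>\<^sup>+g. ennreal (g i) \<partial>snrM m) = (\<integral>\<^sup>+x. ennreal x \<partial>distr (snrM m) (exp_mean (m i)) (\<lambda>g. g i))"
    using e by (subst nn_integral_distr[OF m]) (simp_all only: measurable_distr_eq1)
  also have "distr (snrM m) (exp_mean (m i)) (\<lambda>g. g i) = exp_mean (m i)"
    unfolding snrM_def using assms by (intro distr_PiM_component prob_space_exp_mean) auto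
  finally show ?thesis using assms by (simp add: nn_integral_exp_mean)
qed

lemma psi_snrM_measurable[measurable]: "(\<lambda>g. psi lam i (g i)) \<in> borel_measurable (snrM m)"
  by (rule measurable_compose[OF measurable_snrM_component psi_measurable])

lemma integrable_psi:
  assumes "0 \<le> lam"
  shows "integrable SM (\<lambda>x. psi lam (st_w x) (gw x))"
proof (rule integrableI_bounded)
  \<comment> \<open>Summing over all pairs yields one bound that serves every winner.\<close>
  let ?C = "\<Sum>i\<in>{1..K}. ennreal (tau_d / ln 2) * (ennreal (gD i) + ennreal (g1 i))"
  have "(\<integral>\<^sup>+g. ennreal (psi lam w (g w)) \<partial>snrM gD) \<le> ?C" if w: "w \<in> {1..K}" for w
  proof -
    have "(\<integral>\<^sup>+g. ennreal (psi lam w (g w)) \<partial>snrM gD) \<le>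
        (\<integral>\<^sup>+g. ennreal (tau_d / ln 2) * (ennreal (g w) + ennreal (g1 w)) \<partial>snrM gD)"
    proof (rule nn_integral_mono_AE)
      have "AE g in snrM gD. 0 \<le> g w"
        using w gD by (rule AE_snrM_nonneg)
      then show "AE g in snrM gD. ennreal (psi lam w (g w)) \<le> ennreal (tau_d / ln 2) * (ennreal (g w) + ennreal (g1 w))"
      proof eventually_elim
        case (elim g)
        have "ennreal (psi lam w (g w)) \<le> ennreal (tau_d / ln 2 * (g w + g1 w))"
          using psi_le[OF w elim assms] by (intro ennreal_leI) simp
        also have "\<dots> = ennreal (tau_d / ln 2) * (ennreal (g w) + ennreal (g1 w))"
          using elim tau g1[OF w] by (simp add: ennreal_mult[symmetric] ennreal_plus[symmetric] del: ennreal_plus)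
        finally show ?case .
      qed
    qed
    also have "\<dots> = ennreal (tau_d / ln 2) * (ennreal (gD w) + ennreal (g1 w))"
      using nn_integral_snrM_component[OF w gD] measurable_snrM_component[of w gD]
      by (simp add: nn_integral_cmult nn_integral_add snrD.emeasure_space_1)
    also have "\<dots> \<le> ?C"
      using w by (intro member_le_sum) auto
    finally show ?thesis .
  qed
  then have *: "AE w in winM. (\<integral>\<^sup>+g. ennreal (psi lam w (g w)) \<partial>snrM gD) \<le> ?C"
    using AE_winM by (auto elim: eventually_mono)
  have "(\<integral>\<^sup>+x. ennreal (psi lam (st_w x) (gw x)) \<partial>SM) =
      (\<integral>\<^sup>+w. \<integral>\<^sup>+g. ennreal (psi lam w (g w)) \<partial>snrM gD \<partial>winM)"
    by (subst nn_integral_SM) (simp_all add: st_simps relay.P.emeasure_space_1 slots.emeasure_space_1)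
  also have "\<dots> \<le> (\<integral>\<^sup>+w. ?C \<partial>winM)"
    by (rule nn_integral_mono_AE[OF *])
  also have "\<dots> < \<infinity>"
    by (simp add: win.emeasure_space_1 ennreal_mult_less_top)
  finally show "(\<integral>\<^sup>+x. ennreal (norm (psi lam (st_w x) (gw x))) \<partial>SM) < \<infinity>"
    by (simp add: psi_nonneg)
qed simp

lemma nn_integral_psi:
  "0 \<le> lam \<Longrightarrow> (\<integral>\<^sup>+x. ennreal (psi lam (st_w x) (gw x)) \<partial>SM) = ennreal (Phi lam)"
  unfolding Phi_def by (intro nn_integral_eq_integral integrable_psi AE_I2 psi_nonneg)

lemma AE_SM_winner: "AE x in SM. st_w x \<in> {1..K} \<and> 0 \<le> gw x"
proof -
  \<comment> \<open>Measurability of the exceptional set is what allows the iterated almost-sure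
    statement below to be turned into one on the product space.\<close>
  have m: "{x \<in> space SM. \<not> (st_w x \<in> {1..K} \<and> 0 \<le> gw x)} \<in> sets SM"
    by (rule predE, rule measurable_winner_obs[where F="\<lambda>w g z. \<not> (w \<in> {1..K} \<and> 0 \<le> g)"]) measurable
  have "AE w in winM. AE g in snrM gD. w \<in> {1..K} \<and> 0 \<le> g w"
    using AE_winM by eventually_elim (use AE_snrM_nonneg gD in auto)
  then have "AE w in winM. (\<integral>\<^sup>+g. of_bool (\<not> (w \<in> {1..K} \<and> 0 \<le> g w)) \<partial>snrM gD) = (\<integral>\<^sup>+g. 0 \<partial>snrM gD)"
    by eventually_elim (rule nn_integral_cong_AE, auto elim: eventually_mono)
  then have "(\<integral>\<^sup>+w. \<integral>\<^sup>+g. of_bool (\<not> (w \<in> {1..K} \<and> 0 \<le> g w)) \<partial>snrM gD \<partial>winM) = (\<integral>\<^sup>+w. \<integral>\<^sup>+g. 0 \<partial>snrM gD \<partial>winM)"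
    by (rule nn_integral_cong_AE)
  moreover have "emeasure SM {x \<in> space SM. \<not> (st_w x \<in> {1..K} \<and> 0 \<le> gw x)} =
      (\<integral>\<^sup>+x. of_bool (\<not> (st_w x \<in> {1..K} \<and> 0 \<le> gw x)) \<partial>SM)"
    unfolding nn_integral_indicator[OF m, symmetric]
    by (intro nn_integral_cong) (simp add: indicator_def)
  moreover have "\<dots> = (\<integral>\<^sup>+w. \<integral>\<^sup>+g. of_bool (\<not> (w \<in> {1..K} \<and> 0 \<le> g w)) \<partial>snrM gD \<partial>winM)"
    by (subst nn_integral_SM)
       (rule measurable_winner_obs[where F="\<lambda>w g z. of_bool (\<not> (w \<in> {1..K} \<and> 0 \<le> g))"], measurable,
        simp add: st_simps relay.P.emeasure_space_1 slots.emeasure_space_1)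
  ultimately show ?thesis
    using m by (subst AE_iff_measurable[OF m refl]) simp
qed

lemma Phi_antimono_lipschitz:
  assumes "0 \<le> lam" "lam \<le> mu"
  shows "Phi mu \<le> Phi lam" "Phi lam \<le> Phi mu + (mu - lam) * tau_d"
proof -
  interpret SM: prob_space SM by (rule prob_space_SM)
  have I: "integrable SM (\<lambda>x. psi lam (st_w x) (gw x))" "integrable SM (\<lambda>x. psi mu (st_w x) (gw x))"
    using assms by (auto intro!: integrable_psi)
  have t: "lam * tau_d \<le> mu * tau_d"
    using assms tau by (auto intro!: mult_right_mono)
  show "Phi mu \<le> Phi lam"
    unfolding Phi_def using AE_SM_winner
    by (intro integral_mono_AE I, eventually_elim)
       (use Wf_antimono_lipschitz(1)[of _ _ lam mu] assms t in \<open>fastforce simp: psi_def\<close>)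
  have "Phi lam \<le> (\<integral>x. psi mu (st_w x) (gw x) + (mu - lam) * tau_d \<partial>SM)"
    unfolding Phi_def using AE_SM_winner
  proof (intro integral_mono_AE I, goal_cases)
    case 2
    then show ?case
    proof eventually_elim
      case (elim x)
      then have "Wf (st_w x) (gw x) lam \<le> Wf (st_w x) (gw x) mu + (mu - lam) * tau_d"
        using assms by (intro Wf_antimono_lipschitz) auto
      then show ?case using t unfolding psi_def left_diff_distrib[of mu lam] by linarith
    qed
  qed (use I in auto)
  also have "\<dots> = Phi mu + (mu - lam) * tau_d"
    using I by (simp add: Phi_def SM.prob_space)
  finally show "Phi lam \<le> Phi mu + (mu - lam) * tau_d" .
qed

lemma AE_exp_mean_pos: "AE x in exp_mean m. 0 < x"
proof -
  have "AE x in lborel. x \<noteq> (0::real)" by (rule AE_lborel_singleton)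
  then have "AE x in exp_mean m. x \<noteq> 0"
    unfolding exp_mean_def by (subst AE_density) auto
  then show ?thesis using AE_exp_mean_nonneg by eventually_elim auto
qed

text \<open>If time is free, any positive V2V SNR brings a gain, and an exponential SNR is almost
  surely positive. This excludes 0 as a root.\<close>

lemma Phi_0_pos: "Phi 0 > 0"
proof (rule ccontr)
  interpret SM: prob_space SM by (rule prob_space_SM)
  assume "\<not> Phi 0 > 0"
  then have "(\<integral>\<^sup>+x. ennreal (psi 0 (st_w x) (gw x)) \<partial>SM) = 0"
    by (subst nn_integral_psi) (auto simp: ennreal_neg)
  then have "AE x in SM. ennreal (psi 0 (st_w x) (gw x)) = 0"
    by (subst (asm) nn_integral_0_iff_AE) auto
  from AE_SM[OF this]
  have "AE s in slotsM. AE w in winM. AE g in snrM gD. AE z in snrM g1 \<Otimes>\<^sub>M snrM g2. psi 0 w (g w) \<le> 0"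
    by (simp add: st_simps ennreal_eq_0_iff)
  moreover have "AE s in slotsM. AE w in winM. AE g in snrM gD. AE z in snrM g1 \<Otimes>\<^sub>M snrM g2. psi 0 w (g w) > 0"
  proof (rule AE_I2, use AE_winM in eventually_elim)
    fix w assume w: "w \<in> {1..K}"
    have "AE g in snrM gD. 0 < g w"
      unfolding snrM_def using w gD
      by (intro AE_PiM_component[where P="\<lambda>x. 0 < x"]) (auto intro: prob_space_exp_mean AE_exp_mean_pos)
    then show "AE g in snrM gD. AE z in snrM g1 \<Otimes>\<^sub>M snrM g2. psi 0 w (g w) > 0"
    proof eventually_elim
      case (elim g)
      then have "0 < tau_d * log 2 (1 + g w)" using tau by (intro mult_pos_pos) auto
      then show ?case by (simp add: psi_def less_max_iff_disj)
    qed
  qed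
  ultimately have "AE s in slotsM. AE w in winM. AE g in snrM gD. AE z in snrM g1 \<Otimes>\<^sub>M snrM g2. False"
  proof eventually_elim
    case (elim s)
    then show ?case
    proof eventually_elim
      case (elim w)
      then show ?case
      proof eventually_elim
        case (elim g)
        then show ?case by eventually_elim auto
      qed
    qed
  qed
  then show False by simp
qed

lemma Phi_root:
  "\<exists>lam>0. Phi lam = lam * mean_tw" and
  Phi_root_unique: "0 < lam \<Longrightarrow> 0 < mu \<Longrightarrow> Phi lam = lam * mean_tw \<Longrightarrow> Phi mu = mu * mean_tw \<Longrightarrow> lam = mu"
proof -
  let ?f = "\<lambda>lam. lam * mean_tw - Phi lam"
  \<comment> \<open>By antimonotonicity \<open>Phi ?B \<le> Phi 0 = ?B * mean_tw\<close>, so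
    \<open>?f\<close> has changed its sign by \<open>?B\<close>.\<close>
  let ?B = "Phi 0 / mean_tw"
  have B: "0 < ?B" using Phi_0_pos mean_tw_pos by simp
  have lip: "\<bar>Phi x - Phi y\<bar> \<le> tau_d * \<bar>x - y\<bar>" if "0 \<le> x" "0 \<le> y" for x y
    using Phi_antimono_lipschitz[of x y] Phi_antimono_lipschitz[of y x] that
    by (cases "x \<le> y") (auto simp: abs_if algebra_simps)
  have "tau_d-lipschitz_on {0..?B} Phi"
    using tau lip by (intro lipschitz_onI) (auto simp: dist_real_def)
  then have "continuous_on {0..?B} Phi" by (rule lipschitz_on_continuous_on)
  then have "continuous_on {0..?B} ?f" by (intro continuous_intros)
  moreover have "?f 0 \<le> 0" "0 \<le> ?f ?B"
    using Phi_0_pos mean_tw_pos Phi_antimono_lipschitz(1)[of 0 ?B] B by auto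
  ultimately obtain l where l: "0 \<le> l" "?f l = 0"
    using IVT'[of ?f 0 0 ?B] B by auto
  then have "l \<noteq> 0" using Phi_0_pos by auto
  then show "\<exists>lam>0. Phi lam = lam * mean_tw" using l by (intro exI[of _ l]) auto
  \<comment> \<open>\<open>Phi\<close> cannot grow, whereas \<open>lam * mean_tw\<close> grows
    strictly.\<close>
  have less: False if "0 < lam" "lam < mu" "Phi lam = lam * mean_tw" "Phi mu = mu * mean_tw" for lam mu
    using Phi_antimono_lipschitz(1)[of lam mu] that mean_tw_pos by auto
  show "0 < lam \<Longrightarrow> 0 < mu \<Longrightarrow> Phi lam = lam * mean_tw \<Longrightarrow> Phi mu = mu * mean_tw \<Longrightarrow> lam = mu"
    using less[of lam mu] less[of mu lam] by (cases lam mu rule: linorder_cases) auto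
qed

end

subsection \<open>Unrolling a strategy\<close>

text \<open>The strategy as seen from the second stage: the record of the first stage is put in
  front of every history. Conditioning on a stage thus yields again a strategy that starts from the
  empty history.\<close>

definition next_strategy :: "strategy \<Rightarrow> stage \<Rightarrow> strategy" where
  "next_strategy H x =
    (let a = obs_of x (stage_res H [] x) in (\<lambda>h. fst H (a # h), \<lambda>h. snd H (a # h)))"

lemma stage_res_next_strategy:
  "stage_res (next_strategy H x) h = stage_res H (obs_of x (stage_res H [] x) # h)"
  by (auto simp: next_strategy_def stage_res_def Let_def fun_eq_iff)

text \<open>Histories grow at the end, while \<open>next_strategy\<close> inserts at the front; the
  induction mediates between the two.\<close>

lemma hist_case_nat:
  "hist H (case_nat x \<omega>) (Suc k) = obs_of x (stage_res H [] x) # hist (next_strategy H x) \<omega> k"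
proof (induction k)
  case (Suc k)
  have "hist H (case_nat x \<omega>) (Suc (Suc k)) = hist H (case_nat x \<omega>) (Suc k) @
      [obs_of (\<omega> k) (stage_res H (hist H (case_nat x \<omega>) (Suc k)) (\<omega> k))]"
    by simp
  then show ?case
    unfolding Suc by (simp add: stage_res_next_strategy)
qed simp

lemma res_case_nat:
  "res H (case_nat x \<omega>) 0 = stage_res H [] x"
  "res H (case_nat x \<omega>) (Suc k) = res (next_strategy H x) \<omega> k"
  by (simp_all only: res_def hist_case_nat stage_res_next_strategy hist.simps(1) nat.case)

lemma real_card_less: "real (card {l. l < (k::nat) \<and> P l}) = (\<Sum>l<k. of_bool (P l))"
proof -
  have "{l. l < k \<and> P l} = {..<k} \<inter> {l. P l}" by auto
  then show ?thesis by (simp add: sum_of_bool_eq)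
qed

lemma cost_alt:
  "cost tauR tauC delta tau_d H \<omega> = (\<Sum>l\<le>stop_stage H \<omega>. t_w tauR tauC delta (\<omega> l))
    + (tauR + tauC) * (\<Sum>l<stop_stage H \<omega>. of_bool (res H \<omega> l = Cont True)) + tau_d"
  by (simp add: cost_def Let_def real_card_less)

lemma stop_now:
  assumes "stops (stage_res H [] x)"
  shows "stop_stage H (case_nat x \<omega>) = 0"
    and "reward tau_d tau1 H (case_nat x \<omega>) =
      (if stage_res H [] x = StopV2V then tau_d * log 2 (1 + st_g x (st_w x))
       else (tau_d - tau1) * relay_rate (st_g x (st_w x)) (st_g1 x (st_w x), st_g2 x (st_w x)))"
    and "cost tauR tauC delta tau_d H (case_nat x \<omega>) = t_w tauR tauC delta x + tau_d"
proof -
  show s: "stop_stage H (case_nat x \<omega>) = 0"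
    using assms unfolding stop_stage_def by (intro Least_eq_0) (simp add: res_case_nat)
  show "reward tau_d tau1 H (case_nat x \<omega>) =
      (if stage_res H [] x = StopV2V then tau_d * log 2 (1 + st_g x (st_w x))
       else (tau_d - tau1) * relay_rate (st_g x (st_w x)) (st_g1 x (st_w x), st_g2 x (st_w x)))"
    by (simp add: reward_def s res_case_nat Let_def relay_rate_def)
  show "cost tauR tauC delta tau_d H (case_nat x \<omega>) = t_w tauR tauC delta x + tau_d"
    by (simp add: cost_alt s)
qed

text \<open>The witness \<open>k\<close> is there because \<open>stop_stage\<close> is a
  \<open>LEAST\<close>: its value shifts by one together with the run only if the run stops at
  all.\<close>

lemma stop_later:
  assumes "\<not> stops (stage_res H [] x)" "stops (res (next_strategy H x) \<omega> k)"
  shows "stop_stage H (case_nat x \<omega>) = Suc (stop_stage (next_strategy H x) \<omega>)"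
    and "reward tau_d tau1 H (case_nat x \<omega>) = reward tau_d tau1 (next_strategy H x) \<omega>"
    and "cost tauR tauC delta tau_d H (case_nat x \<omega>) =
      t_w tauR tauC delta x + (tauR + tauC) * of_bool (stage_res H [] x = Cont True)
      + cost tauR tauC delta tau_d (next_strategy H x) \<omega>"
proof -
  show s: "stop_stage H (case_nat x \<omega>) = Suc (stop_stage (next_strategy H x) \<omega>)"
    unfolding stop_stage_def using assms
    by (subst Least_Suc[of _ "Suc k"]) (simp_all add: res_case_nat)
  show "reward tau_d tau1 H (case_nat x \<omega>) = reward tau_d tau1 (next_strategy H x) \<omega>"
    by (simp add: reward_def s res_case_nat Let_def)
  show "cost tauR tauC delta tau_d H (case_nat x \<omega>) =
      t_w tauR tauC delta x + (tauR + tauC) * of_bool (stage_res H [] x = Cont True)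
      + cost tauR tauC delta tau_d (next_strategy H x) \<omega>"
    unfolding cost_alt s sum.atMost_Suc_shift sum.lessThan_Suc_shift
    by (simp add: res_case_nat algebra_simps)
qed

section \<open>Comparing gain and price of time within one stage\<close>

context rsu_access
begin

lemma cost_ge: "tau_d \<le> cost tauR tauC delta tau_d H \<omega>"
  using tau unfolding cost_alt
  by (auto intro!: add_nonneg_nonneg sum_nonneg mult_nonneg_nonneg less_imp_le[OF tw_pos])

lemma measurable_section:
  assumes "s \<in> space slotsM" "g \<in> space (snrM gD)"
  shows "(\<lambda>z. (s, w, g, z)) \<in> snrM g1 \<Otimes>\<^sub>M snrM g2 \<rightarrow>\<^sub>M SM"
  unfolding SM_eq using assms
  by (intro measurable_Pair measurable_const measurable_ident) (auto simp: winM_def)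

lemma nn_integral_SM_tw: "(\<integral>\<^sup>+x. ennreal (tw x) \<partial>SM) = ennreal mean_tw"
proof -
  have "tw (s, w, g, z) = tw (s, undefined)" for s w g z by (rule tw_fst)
  then show ?thesis
    by (subst nn_integral_SM)
       (simp_all add: nn_integral_tw relay.P.emeasure_space_1 snrD.emeasure_space_1 win.emeasure_space_1)
qed

text \<open>It is enough to compare the integrals over the relay SNRs with the first observation
  held fixed. \<open>P\<close> passes through Fubini without being measurable, so it may mention the
  decisions of an arbitrary strategy.\<close>

lemma nn_integral_SM_mono:
  assumes [measurable]: "A \<in> borel_measurable SM" "B \<in> borel_measurable SM"
    and "\<And>s w g. s \<in> space slotsM \<Longrightarrow> w \<in> {1..K} \<Longrightarrow> g \<in> space (snrM gD) \<Longrightarrow> 0 \<le> g w \<Longrightarrow>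
      AE z in snrM g1 \<Otimes>\<^sub>M snrM g2. P (s, w, g, z) \<Longrightarrow>
      (\<integral>\<^sup>+z. A (s, w, g, z) \<partial>(snrM g1 \<Otimes>\<^sub>M snrM g2)) \<le> (\<integral>\<^sup>+z. B (s, w, g, z) \<partial>(snrM g1 \<Otimes>\<^sub>M snrM g2))"
    and "AE x in SM. P x"
  shows "(\<integral>\<^sup>+x. A x \<partial>SM) \<le> (\<integral>\<^sup>+x. B x \<partial>SM)"
  unfolding nn_integral_SM[OF assms(1)] nn_integral_SM[OF assms(2)]
proof (rule nn_integral_mono_AE)
  show "AE s in slotsM. (\<integral>\<^sup>+w. \<integral>\<^sup>+g. \<integral>\<^sup>+z. A (s, w, g, z) \<partial>(snrM g1 \<Otimes>\<^sub>M snrM g2) \<partial>snrM gD \<partial>winM) \<le>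
      (\<integral>\<^sup>+w. \<integral>\<^sup>+g. \<integral>\<^sup>+z. B (s, w, g, z) \<partial>(snrM g1 \<Otimes>\<^sub>M snrM g2) \<partial>snrM gD \<partial>winM)"
    using AE_SM[OF assms(4)] AE_space
  proof eventually_elim
    case (elim s)
    note s = elim(2)
    show ?case
    proof (rule nn_integral_mono_AE, use elim(1) AE_winM in eventually_elim)
      case (elim w)
      have "AE g in snrM gD. 0 \<le> g w" using elim(2) gD by (rule AE_snrM_nonneg)
      with elim(1) AE_space[of "snrM gD"]
      have "AE g in snrM gD. (\<integral>\<^sup>+z. A (s, w, g, z) \<partial>(snrM g1 \<Otimes>\<^sub>M snrM g2)) \<le>
          (\<integral>\<^sup>+z. B (s, w, g, z) \<partial>(snrM g1 \<Otimes>\<^sub>M snrM g2))"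
        by eventually_elim (rule assms(3)[OF s elim(2)])
      then show ?case by (rule nn_integral_mono_AE)
    qed
  qed
qed

text \<open>In the upper bound, \<open>A x\<close> and \<open>B x\<close> are mean reward and mean
  cost given the first stage \<open>x\<close>, and \<open>d\<close> is the decision to probe. After
  a probe the pointwise bound involves \<open>pay\<close>, of which only the mean over the relay
  SNRs, \<open>W\<close>, is below \<open>psi\<close>. The integral of \<open>psi\<close> is
  \<open>Phi lam = lam * mean_tw\<close> and cancels the contention time on the left.\<close>

lemma nn_integral_stage_le:
  assumes lam: "0 < lam" "Phi lam = lam * mean_tw"
    and A[measurable]: "A \<in> borel_measurable SM" and B[measurable]: "B \<in> borel_measurable SM"
    and probe: "AE x in SM. d (st_w x) (gw x) \<longrightarrow> A x + ennreal (lam * tw x) + ennreal (lam * tau1)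
        \<le> ennreal lam * B x + ennreal (pay lam (gw x) (zw x) + lam * tau1)"
    and no_probe: "AE x in SM. \<not> d (st_w x) (gw x) \<longrightarrow> A x + ennreal (lam * tw x)
        \<le> ennreal lam * B x + ennreal (max (tau_d * log 2 (1 + gw x) - lam * tau_d) 0)"
  shows "(\<integral>\<^sup>+x. A x \<partial>SM) \<le> ennreal lam * (\<integral>\<^sup>+x. B x \<partial>SM)"
proof -
  let ?Z = "snrM g1 \<Otimes>\<^sub>M snrM g2"
  have "(\<integral>\<^sup>+x. A x + ennreal (lam * tw x) \<partial>SM) \<le> (\<integral>\<^sup>+x. ennreal lam * B x + ennreal (psi lam (st_w x) (gw x)) \<partial>SM)"
  proof (rule nn_integral_SM_mono)
    fix s w g
    assume s: "s \<in> space slotsM" and w: "w \<in> {1..K}" and g: "g \<in> space (snrM gD)" "0 \<le> g w"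
    note [measurable] = measurable_compose[OF measurable_section[OF s g(1)] A]
      measurable_compose[OF measurable_section[OF s g(1)] B]
    have tws: "tw (s, w, g, z) = tw (s, undefined)" for z by (rule tw_fst)
    assume AE: "AE z in ?Z. (d (st_w (s, w, g, z)) (gw (s, w, g, z)) \<longrightarrow>
        A (s, w, g, z) + ennreal (lam * tw (s, w, g, z)) + ennreal (lam * tau1)
        \<le> ennreal lam * B (s, w, g, z) + ennreal (pay lam (gw (s, w, g, z)) (zw (s, w, g, z)) + lam * tau1)) \<and>
       (\<not> d (st_w (s, w, g, z)) (gw (s, w, g, z)) \<longrightarrow> A (s, w, g, z) + ennreal (lam * tw (s, w, g, z))
        \<le> ennreal lam * B (s, w, g, z) + ennreal (max (tau_d * log 2 (1 + gw (s, w, g, z)) - lam * tau_d) 0))"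
    show "(\<integral>\<^sup>+z. A (s, w, g, z) + ennreal (lam * tw (s, w, g, z)) \<partial>?Z) \<le>
        (\<integral>\<^sup>+z. ennreal lam * B (s, w, g, z) + ennreal (psi lam (st_w (s, w, g, z)) (gw (s, w, g, z))) \<partial>?Z)"
    proof (cases "d w (g w)")
      case False
      show ?thesis
        using AE
      proof (intro nn_integral_mono_AE, eventually_elim)
        case (elim z)
        then have "A (s, w, g, z) + ennreal (lam * tw (s, w, g, z))
          \<le> ennreal lam * B (s, w, g, z) + ennreal (max (tau_d * log 2 (1 + g w) - lam * tau_d) 0)"
          using False by (simp add: st_simps)
        also have "\<dots> \<le> ennreal lam * B (s, w, g, z) + ennreal (psi lam w (g w))"
          by (intro add_left_mono ennreal_leI) (simp add: psi_def)
        finally show ?case by (simp add: st_simps)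
      qed
    next
      case True
      let ?a = "\<lambda>z. A (s, w, g, z) + ennreal (lam * tw (s, undefined))"
      have "(\<integral>\<^sup>+z. ?a z \<partial>?Z) + ennreal (lam * tau1) = (\<integral>\<^sup>+z. ?a z + ennreal (lam * tau1) \<partial>?Z)"
        by (subst nn_integral_add) (simp_all add: relay.P.emeasure_space_1)
      also have "\<dots> \<le> (\<integral>\<^sup>+z. ennreal lam * B (s, w, g, z) + ennreal (pay lam (g w) (fst z w, snd z w) + lam * tau1) \<partial>?Z)"
        using AE True by (intro nn_integral_mono_AE) (auto simp: st_simps tws elim: eventually_mono)
      also have "\<dots> = (\<integral>\<^sup>+z. ennreal lam * B (s, w, g, z) \<partial>?Z) + ennreal (Wf w (g w) lam + lam * tau1)"
        using w g lam by (subst nn_integral_add) (auto simp: nn_integral_pay)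
      also have "\<dots> \<le> (\<integral>\<^sup>+z. ennreal lam * B (s, w, g, z) \<partial>?Z) + (ennreal (psi lam w (g w)) + ennreal (lam * tau1))"
        using lam tau psi_nonneg
        by (subst ennreal_plus[symmetric]) (auto intro!: add_left_mono ennreal_leI simp: psi_def simp del: ennreal_plus)
      also have "\<dots> = (\<integral>\<^sup>+z. ennreal lam * B (s, w, g, z) + ennreal (psi lam w (g w)) \<partial>?Z) + ennreal (lam * tau1)"
        by (subst nn_integral_add) (simp_all add: relay.P.emeasure_space_1 add.assoc)
      finally show ?thesis
        by (simp add: st_simps tws ennreal_add_left_cancel_le add.commute[of _ "ennreal (lam * tau1)"] del: ennreal_plus)
    qed
  qed (use probe no_probe in \<open>auto elim: eventually_elim2\<close>)
  also have "(\<integral>\<^sup>+x. A x + ennreal (lam * tw x) \<partial>SM) = (\<integral>\<^sup>+x. A x \<partial>SM) + ennreal (lam * mean_tw)"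
    using lam tw_pos mean_tw_pos
    by (subst nn_integral_add) (simp_all add: ennreal_mult' nn_integral_cmult nn_integral_SM_tw)
  also have "(\<integral>\<^sup>+x. ennreal lam * B x + ennreal (psi lam (st_w x) (gw x)) \<partial>SM) =
      ennreal lam * (\<integral>\<^sup>+x. B x \<partial>SM) + ennreal (lam * mean_tw)"
    using lam by (subst nn_integral_add) (simp_all add: nn_integral_cmult nn_integral_psi)
  finally show ?thesis
    by (simp add: ennreal_add_left_cancel_le add.commute[of _ "ennreal (lam * mean_tw)"])
qed

subsection \<open>The upper bound\<close>

lemma prob_space_OM: "prob_space OM"
  unfolding Omega_def by (intro prob_space_PiM prob_space_SM)

lemma case_nat_measurable[measurable]: "(\<lambda>(x, \<omega>). case_nat x \<omega>) \<in> SM \<Otimes>\<^sub>M OM \<rightarrow>\<^sub>M OM"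
  unfolding Omega_def by measurable

lemma nn_integral_OM_case_nat:
  "f \<in> borel_measurable OM \<Longrightarrow> (\<integral>\<^sup>+\<omega>. f \<omega> \<partial>OM) = (\<integral>\<^sup>+x. \<integral>\<^sup>+\<omega>. f (case_nat x \<omega>) \<partial>OM \<partial>SM)"
  unfolding Omega_def by (rule nn_integral_PiM_case_nat[OF prob_space_SM])

lemma borel_measurable_nn_integral_case_nat:
  assumes [measurable]: "f \<in> borel_measurable OM"
  shows "(\<lambda>x. \<integral>\<^sup>+\<omega>. f (case_nat x \<omega>) \<partial>OM) \<in> borel_measurable SM"
proof -
  interpret OM: prob_space OM by (rule prob_space_OM)
  have "(\<lambda>(x, \<omega>). f (case_nat x \<omega>)) \<in> borel_measurable (SM \<Otimes>\<^sub>M OM)"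
    using measurable_compose[OF case_nat_measurable assms] by (simp add: split_beta')
  then show ?thesis by (rule OM.borel_measurable_nn_integral)
qed

text \<open>A strategy need not be measurable, only its reward and cost are, so the decision made in a
  stage is never integrated over. The strategy is unrolled from the front: once the first observation of
  the first stage is fixed, the decision to probe is fixed as well, and \<open>nn_integral_stage_le\<close>
  integrates out the second observation first. The functions \<open>Y\<close> and \<open>T\<close> are measurable versions,
  since reward and cost are arbitrary where the strategy does not stop.
  The truncation at \<open>T \<le> n * tau1\<close> makes the induction possible, because every stage costs at
  least \<open>tau1\<close>.\<close>

lemma truncated_reward_le_cost:
  assumes lam: "0 < lam" "Phi lam = lam * mean_tw"
  shows "Y \<in> borel_measurable OM \<Longrightarrow> T \<in> borel_measurable OM \<Longrightarrow>
    AE \<omega> in OM. (\<exists>k. stops (res H \<omega> k)) \<and> Y \<omega> = reward tau_d tau1 H \<omega> \<and>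
      T \<omega> = cost tauR tauC delta tau_d H \<omega> \<Longrightarrow>
    (\<integral>\<^sup>+\<omega>. ennreal (Y \<omega>) * of_bool (T \<omega> \<le> real n * tau1) \<partial>OM) \<le> ennreal lam * (\<integral>\<^sup>+\<omega>. ennreal (T \<omega>) \<partial>OM)"
proof (induction n arbitrary: H Y T)
  case 0
  \<comment> \<open>The truncation at 0 leaves nothing, as every run costs at least
    \<open>tau_d\<close>.\<close>
  have "AE \<omega> in OM. ennreal (Y \<omega>) * of_bool (T \<omega> \<le> real 0 * tau1) = 0"
    using 0(3)
  proof eventually_elim
    case (elim \<omega>)
    then have "0 < T \<omega>" using cost_ge[of H \<omega>] tau by simp
    then show ?case by simp
  qed
  then have "(\<integral>\<^sup>+\<omega>. ennreal (Y \<omega>) * of_bool (T \<omega> \<le> real 0 * tau1) \<partial>OM) = (\<integral>\<^sup>+\<omega>. 0 \<partial>OM)"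
    by (rule nn_integral_cong_AE)
  then show ?case by simp
next
  case (Suc n)
  interpret OM: prob_space OM by (rule prob_space_OM)
  note [measurable] = Suc.prems(1,2)
  define A where "A x = (\<integral>\<^sup>+\<omega>. ennreal (Y (case_nat x \<omega>)) * of_bool (T (case_nat x \<omega>) \<le> real (Suc n) * tau1) \<partial>OM)" for x
  define B where "B x = (\<integral>\<^sup>+\<omega>. ennreal (T (case_nat x \<omega>)) \<partial>OM)" for x
  have A_meas: "A \<in> borel_measurable SM"
    unfolding A_def[abs_def] by (rule borel_measurable_nn_integral_case_nat) measurable
  have B_meas: "B \<in> borel_measurable SM"
    unfolding B_def[abs_def] by (rule borel_measurable_nn_integral_case_nat) measurable
  have "AE x in SM. AE \<omega> in OM. (\<exists>k. stops (res H (case_nat x \<omega>) k)) \<and> Y (case_nat x \<omega>) = reward tau_d tau1 H (case_nat x \<omega>) \<and>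
      T (case_nat x \<omega>) = cost tauR tauC delta tau_d H (case_nat x \<omega>)"
    using AE_PiM_case_nat[OF prob_space_SM Suc.prems(3)[unfolded Omega_def]] unfolding Omega_def .
  then have bounds: "AE x in SM.
      (fst H [] (st_w x) (gw x) = Probe \<longrightarrow> A x + ennreal (lam * tw x) + ennreal (lam * tau1)
        \<le> ennreal lam * B x + ennreal (pay lam (gw x) (zw x) + lam * tau1)) \<and>
      (fst H [] (st_w x) (gw x) \<noteq> Probe \<longrightarrow> A x + ennreal (lam * tw x)
        \<le> ennreal lam * B x + ennreal (max (tau_d * log 2 (1 + gw x) - lam * tau_d) 0))"
    using AE_space
  proof eventually_elim
    case (elim x)
    note AE = elim(1) and x = elim(2)
    let ?r = "stage_res H [] x"
    have sect: "case_nat x \<in> OM \<rightarrow>\<^sub>M OM"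
      using measurable_compose[OF measurable_Pair1'[OF x] case_nat_measurable] by simp
    note [measurable] = measurable_compose[OF sect Suc.prems(1)] measurable_compose[OF sect Suc.prems(2)]
    have nonneg: "0 \<le> lam * tw x" "0 \<le> lam * tau1" "0 \<le> lam * tau_d"
      using lam tau tw_pos[of x] by auto
    show ?case
    proof (cases ?r)
      case (Cont b)
      \<comment> \<open>\<open>?c\<close> is the time used by the first stage when it ends in
        re-contention, and \<open>T - ?c\<close> the cost of the remaining run under
        \<open>?H\<close>. Since \<open>?c\<close> is at least \<open>tau1\<close>, a total of at
        most \<open>Suc n * tau1\<close> leaves at most \<open>n * tau1\<close>, which is where the
        induction hypothesis applies.\<close>
      let ?H = "next_strategy H x" and ?c = "tw x + tau1 * of_bool b"
      have ns: "\<not> stops ?r" by (simp add: stops_def Cont)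
      have AE': "AE \<omega> in OM. (\<exists>k. stops (res ?H \<omega> k)) \<and> Y (case_nat x \<omega>) = reward tau_d tau1 ?H \<omega> \<and>
          T (case_nat x \<omega>) - ?c = cost tauR tauC delta tau_d ?H \<omega>"
        using AE
      proof eventually_elim
        case (elim \<omega>)
        then obtain k where k: "stops (res H (case_nat x \<omega>) k)" by auto
        with ns obtain j where "k = Suc j" by (cases k) (auto simp: res_case_nat)
        with k have "stops (res ?H \<omega> j)" by (simp add: res_case_nat)
        then show ?case using elim stop_later[OF ns] Cont by auto
      qed
      have c: "tau1 \<le> ?c" using tw_ge[of x] tau by simp
      have lc: "ennreal (lam * ?c) = ennreal lam * ennreal ?c"
        by (rule ennreal_mult) (use lam c tau in linarith)+
      have "A x \<le> (\<integral>\<^sup>+\<omega>. ennreal (Y (case_nat x \<omega>)) * of_bool (T (case_nat x \<omega>) - ?c \<le> real n * tau1) \<partial>OM)"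
        unfolding A_def using c by (intro nn_integral_mono mult_left_mono) (auto simp: algebra_simps)
      also have "\<dots> \<le> ennreal lam * (\<integral>\<^sup>+\<omega>. ennreal (T (case_nat x \<omega>) - ?c) \<partial>OM)"
        by (rule Suc.IH[OF _ _ AE']) measurable
      finally have "A x + ennreal (lam * ?c) \<le>
          ennreal lam * (\<integral>\<^sup>+\<omega>. ennreal (T (case_nat x \<omega>) - ?c) \<partial>OM) + ennreal (lam * ?c)"
        by (rule add_right_mono)
      also have "\<dots> = ennreal lam * ((\<integral>\<^sup>+\<omega>. ennreal (T (case_nat x \<omega>) - ?c) \<partial>OM) + ennreal ?c)"
        unfolding lc by (rule distrib_left[symmetric])
      also have "(\<integral>\<^sup>+\<omega>. ennreal (T (case_nat x \<omega>) - ?c) \<partial>OM) + ennreal ?c =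
          (\<integral>\<^sup>+\<omega>. ennreal (T (case_nat x \<omega>) - ?c) + ennreal ?c \<partial>OM)"
        by (subst nn_integral_add) (simp_all add: OM.emeasure_space_1)
      also have "\<dots> = B x"
        unfolding B_def using AE'
      proof (intro nn_integral_cong_AE, eventually_elim)
        case (elim \<omega>)
        then have "0 \<le> T (case_nat x \<omega>) - ?c" using cost_ge[of ?H \<omega>] tau by simp
        then show ?case using c tau by (subst ennreal_plus[symmetric]) auto
      qed
      finally have main: "A x + ennreal (lam * ?c) \<le> ennreal lam * B x" .
      show ?thesis
      proof (cases b)
        case True
        have "ennreal (lam * ?c) = ennreal (lam * tw x) + ennreal (lam * tau1)"
          using True nonneg by (subst ennreal_plus[symmetric]) (auto simp: algebra_simps)
        moreover have "fst H [] (st_w x) (gw x) = Probe"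
          using Cont True by (auto simp: stage_res_def Let_def split: act1.splits)
        moreover have "ennreal lam * B x \<le> ennreal lam * B x + ennreal (pay lam (gw x) (zw x) + lam * tau1)"
          by simp
        ultimately show ?thesis using main order_trans by (simp only: add.assoc) blast
      next
        case False
        have "fst H [] (st_w x) (gw x) = Recont"
          using Cont False by (auto simp: stage_res_def Let_def split: act1.splits if_splits)
        have "A x + ennreal (lam * tw x) \<le> ennreal lam * B x" using main False by simp
        also have "\<dots> \<le> ennreal lam * B x + ennreal (max (tau_d * log 2 (1 + gw x) - lam * tau_d) 0)"
          by simp
        finally show ?thesis using \<open>fst H [] (st_w x) (gw x) = Recont\<close> by simp
      qed
    next
      case StopV2V
      have st: "stops ?r" by (simp add: StopV2V stops_def)
      let ?y = "tau_d * log 2 (1 + gw x)"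
      have "A x \<le> (\<integral>\<^sup>+\<omega>. ennreal ?y \<partial>OM)"
        unfolding A_def
        by (rule nn_integral_mono_AE, use AE in eventually_elim) (simp add: stop_now[OF st] StopV2V)
      then have "A x \<le> ennreal ?y" by (simp add: OM.emeasure_space_1)
      moreover have "B x = (\<integral>\<^sup>+\<omega>. ennreal (tw x + tau_d) \<partial>OM)"
        unfolding B_def
        by (rule nn_integral_cong_AE, use AE in eventually_elim) (simp add: stop_now[OF st])
      then have "ennreal lam * B x = ennreal (lam * tw x) + ennreal (lam * tau_d)"
        using lam tau tw_pos[of x]
        by (simp add: OM.emeasure_space_1 ennreal_mult distrib_left)
      moreover have "ennreal ?y \<le> ennreal (lam * tau_d) + ennreal (max (?y - lam * tau_d) 0)"
        using nonneg by (subst ennreal_plus[symmetric]) (auto intro!: ennreal_leI simp del: ennreal_plus)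
      ultimately have "A x + ennreal (lam * tw x) \<le> ennreal lam * B x + ennreal (max (?y - lam * tau_d) 0)"
        by (smt (verit) add.assoc add.commute add_left_mono order_trans)
      moreover have "fst H [] (st_w x) (gw x) = Stop1"
        using StopV2V by (auto simp: stage_res_def Let_def split: act1.splits if_splits)
      ultimately show ?thesis by simp
    next
      case StopRelay
      have st: "stops ?r" by (simp add: StopRelay stops_def)
      let ?y = "(tau_d - tau1) * relay_rate (gw x) (zw x)"
      have "A x \<le> (\<integral>\<^sup>+\<omega>. ennreal ?y \<partial>OM)"
        unfolding A_def
        by (rule nn_integral_mono_AE, use AE in eventually_elim) (simp add: stop_now[OF st] StopRelay)
      then have "A x \<le> ennreal ?y" by (simp add: OM.emeasure_space_1)
      moreover have "B x = (\<integral>\<^sup>+\<omega>. ennreal (tw x + tau_d) \<partial>OM)"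
        unfolding B_def
        by (rule nn_integral_cong_AE, use AE in eventually_elim) (simp add: stop_now[OF st])
      then have "ennreal lam * B x = ennreal (lam * tw x) + ennreal (lam * tau_d)"
        using lam tau tw_pos[of x]
        by (simp add: OM.emeasure_space_1 ennreal_mult distrib_left)
      moreover have "ennreal ?y + ennreal (lam * tau1) \<le> ennreal (lam * tau_d) + ennreal (pay lam (gw x) (zw x) + lam * tau1)"
      proof -
        have p: "?y - lam * tau_d \<le> pay lam (gw x) (zw x)" "0 \<le> pay lam (gw x) (zw x) + lam * tau1"
          using pay_ge[of lam "gw x" "zw x"] by (auto simp: pay_def)
        \<comment> \<open>For SNRs outside the support of their law \<open>?y\<close> may be
          negative and is then read as 0 by \<open>ennreal\<close>; in that case this inequality
          carries the bound.\<close>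
        have "lam * tau1 \<le> lam * tau_d" using lam tau by (intro mult_left_mono) auto
        then have "ennreal (max ?y 0 + lam * tau1) \<le> ennreal (lam * tau_d + (pay lam (gw x) (zw x) + lam * tau1))"
          using p by (intro ennreal_leI) linarith
        moreover have "ennreal ?y = ennreal (max ?y 0)" by (auto simp: max_def ennreal_neg)
        ultimately show ?thesis using nonneg p by (simp only: ennreal_plus max.cobounded2)
      qed
      ultimately have "A x + ennreal (lam * tw x) + ennreal (lam * tau1)
          \<le> ennreal lam * B x + ennreal (pay lam (gw x) (zw x) + lam * tau1)"
        by (smt (verit) add.assoc add.commute add_left_mono order_trans)
      moreover have "fst H [] (st_w x) (gw x) = Probe"
        using StopRelay by (auto simp: stage_res_def Let_def split: act1.splits)
      ultimately show ?thesis by simp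
    qed
  qed
  have "(\<integral>\<^sup>+x. A x \<partial>SM) \<le> ennreal lam * (\<integral>\<^sup>+x. B x \<partial>SM)"
    using bounds
    by (intro nn_integral_stage_le[OF lam A_meas B_meas, where d="\<lambda>w g. fst H [] w g = Probe"])
       (auto elim: eventually_mono)
  also have "(\<integral>\<^sup>+x. B x \<partial>SM) = (\<integral>\<^sup>+\<omega>. ennreal (T \<omega>) \<partial>OM)"
    unfolding B_def by (rule nn_integral_OM_case_nat[symmetric]) measurable
  also have "(\<integral>\<^sup>+x. A x \<partial>SM) = (\<integral>\<^sup>+\<omega>. ennreal (Y \<omega>) * of_bool (T \<omega> \<le> real (Suc n) * tau1) \<partial>OM)"
    unfolding A_def by (rule nn_integral_OM_case_nat[symmetric]) measurable
  finally show ?case .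
qed

text \<open>Costs are real numbers, so each run lies below the truncation level for large
  \<open>n\<close>, and monotone convergence removes the truncation.\<close>

lemma reward_le_cost:
  assumes lam: "0 < lam" "Phi lam = lam * mean_tw"
    and H: "admissible OM (reward tau_d tau1) (cost tauR tauC delta tau_d) H"
  shows "(\<integral>\<^sup>+\<omega>. ennreal (reward tau_d tau1 H \<omega>) \<partial>OM) \<le>
    ennreal lam * (\<integral>\<^sup>+\<omega>. ennreal (cost tauR tauC delta tau_d H \<omega>) \<partial>OM)"
proof -
  let ?Y = "reward tau_d tau1 H" and ?T = "cost tauR tauC delta tau_d H"
  have [measurable]: "?Y \<in> borel_measurable OM" "?T \<in> borel_measurable OM"
    and AE: "AE \<omega> in OM. \<exists>k. stops (res H \<omega> k)"
    using H by (auto simp: admissible_def)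
  let ?f = "\<lambda>n \<omega>. ennreal (?Y \<omega>) * of_bool (?T \<omega> \<le> real n * tau1)"
  have le: "(\<integral>\<^sup>+\<omega>. ?f n \<omega> \<partial>OM) \<le> ennreal lam * (\<integral>\<^sup>+\<omega>. ennreal (?T \<omega>) \<partial>OM)" for n
    using AE by (intro truncated_reward_le_cost[OF lam, where H=H]) auto
  have sup: "(SUP n. ?f n \<omega>) = ennreal (?Y \<omega>)" for \<omega>
  proof (rule antisym)
    show "(SUP n. ?f n \<omega>) \<le> ennreal (?Y \<omega>)" by (intro SUP_least) auto
    obtain n :: nat where "?T \<omega> / tau1 \<le> real n" using real_arch_simple by blast
    then have "?T \<omega> \<le> real n * tau1" using tau by (simp add: pos_divide_le_eq)
    then show "ennreal (?Y \<omega>) \<le> (SUP n. ?f n \<omega>)" by (intro SUP_upper2[of n]) auto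
  qed
  have inc: "incseq ?f"
  proof (intro incseq_SucI le_funI mult_left_mono)
    fix n \<omega>
    have "real n * tau1 \<le> real (Suc n) * tau1" using tau by (intro mult_right_mono) auto
    then show "(of_bool (?T \<omega> \<le> real n * tau1) :: ennreal) \<le> of_bool (?T \<omega> \<le> real (Suc n) * tau1)"
      by auto
  qed auto
  have "(\<integral>\<^sup>+\<omega>. ennreal (?Y \<omega>) \<partial>OM) = (SUP n. \<integral>\<^sup>+\<omega>. ?f n \<omega> \<partial>OM)"
    by (subst nn_integral_monotone_convergence_SUP[OF inc, symmetric]) (simp_all add: sup)
  also have "\<dots> \<le> ennreal lam * (\<integral>\<^sup>+\<omega>. ennreal (?T \<omega>) \<partial>OM)"
    by (intro SUP_least le)
  finally show ?thesis .
qed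

subsection \<open>The threshold strategy\<close>

text \<open>The counterpart of \<open>nn_integral_stage_le\<close> for decisions that attain
  \<open>psi\<close>: where the rule probes, \<open>W\<close> has to be the largest of the three
  options.\<close>

lemma nn_integral_stage_ge:
  assumes lam: "0 < lam" "Phi lam = lam * mean_tw"
    and A[measurable]: "A \<in> borel_measurable SM" and B[measurable]: "B \<in> borel_measurable SM"
    and probe: "\<And>x. d (st_w x) (gw x) \<Longrightarrow> psi lam (st_w x) (gw x) = Wf (st_w x) (gw x) lam \<and>
      ennreal lam * B x + ennreal (pay lam (gw x) (zw x) + lam * tau1)
        \<le> A x + ennreal (lam * tw x) + ennreal (lam * tau1)"
    and no_probe: "\<And>x. \<not> d (st_w x) (gw x) \<Longrightarrow>
      ennreal lam * B x + ennreal (psi lam (st_w x) (gw x)) \<le> A x + ennreal (lam * tw x)"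
  shows "ennreal lam * (\<integral>\<^sup>+x. B x \<partial>SM) \<le> (\<integral>\<^sup>+x. A x \<partial>SM)"
proof -
  let ?Z = "snrM g1 \<Otimes>\<^sub>M snrM g2"
  have "(\<integral>\<^sup>+x. ennreal lam * B x + ennreal (psi lam (st_w x) (gw x)) \<partial>SM) \<le> (\<integral>\<^sup>+x. A x + ennreal (lam * tw x) \<partial>SM)"
  proof (rule nn_integral_SM_mono[where P="\<lambda>_. True"])
    fix s w g
    assume s: "s \<in> space slotsM" and w: "w \<in> {1..K}" and g: "g \<in> space (snrM gD)" "0 \<le> g w"
    note [measurable] = measurable_compose[OF measurable_section[OF s g(1)] A]
      measurable_compose[OF measurable_section[OF s g(1)] B]
    have tws: "tw (s, w, g, z) = tw (s, undefined)" for z by (rule tw_fst)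
    show "(\<integral>\<^sup>+z. ennreal lam * B (s, w, g, z) + ennreal (psi lam (st_w (s, w, g, z)) (gw (s, w, g, z))) \<partial>?Z) \<le>
        (\<integral>\<^sup>+z. A (s, w, g, z) + ennreal (lam * tw (s, w, g, z)) \<partial>?Z)"
    proof (cases "d w (g w)")
      case False
      then show ?thesis
        by (intro nn_integral_mono no_probe) (simp add: st_simps)
    next
      case True
      let ?a = "\<lambda>z. A (s, w, g, z) + ennreal (lam * tw (s, undefined))"
      have psi: "psi lam w (g w) = Wf w (g w) lam"
        using probe[of "(s, w, g, undefined)"] True by (simp add: st_simps)
      have "(\<integral>\<^sup>+z. ennreal lam * B (s, w, g, z) + ennreal (psi lam w (g w)) \<partial>?Z) + ennreal (lam * tau1) =
          (\<integral>\<^sup>+z. ennreal lam * B (s, w, g, z) \<partial>?Z) + (ennreal (psi lam w (g w)) + ennreal (lam * tau1))"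
        by (subst nn_integral_add) (simp_all add: relay.P.emeasure_space_1 add.assoc)
      also have "\<dots> = (\<integral>\<^sup>+z. ennreal lam * B (s, w, g, z) \<partial>?Z) + ennreal (Wf w (g w) lam + lam * tau1)"
        using lam tau psi_nonneg[of lam w "g w"] by (subst ennreal_plus[symmetric]) (auto simp: psi simp del: ennreal_plus)
      also have "\<dots> = (\<integral>\<^sup>+z. ennreal lam * B (s, w, g, z) + ennreal (pay lam (g w) (fst z w, snd z w) + lam * tau1) \<partial>?Z)"
        using w g lam by (subst nn_integral_add) (auto simp: nn_integral_pay)
      also have "\<dots> \<le> (\<integral>\<^sup>+z. ?a z + ennreal (lam * tau1) \<partial>?Z)"
      proof (rule nn_integral_mono)
        fix z
        show "ennreal lam * B (s, w, g, z) + ennreal (pay lam (g w) (fst z w, snd z w) + lam * tau1) \<le> ?a z + ennreal (lam * tau1)"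
          using probe[of "(s, w, g, z)"] True unfolding st_simps tws by blast
      qed
      also have "\<dots> = (\<integral>\<^sup>+z. ?a z \<partial>?Z) + ennreal (lam * tau1)"
        by (subst nn_integral_add) (simp_all add: relay.P.emeasure_space_1)
      finally show ?thesis
        by (simp add: st_simps tws ennreal_add_left_cancel_le add.commute[of _ "ennreal (lam * tau1)"] del: ennreal_plus)
    qed
  qed simp_all
  also have "(\<integral>\<^sup>+x. A x + ennreal (lam * tw x) \<partial>SM) = (\<integral>\<^sup>+x. A x \<partial>SM) + ennreal (lam * mean_tw)"
    using lam tw_pos mean_tw_pos
    by (subst nn_integral_add) (simp_all add: ennreal_mult' nn_integral_cmult nn_integral_SM_tw)
  also have "(\<integral>\<^sup>+x. ennreal lam * B x + ennreal (psi lam (st_w x) (gw x)) \<partial>SM) =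
      ennreal lam * (\<integral>\<^sup>+x. B x \<partial>SM) + ennreal (lam * mean_tw)"
    using lam by (subst nn_integral_add) (simp_all add: nn_integral_cmult nn_integral_psi)
  finally show ?thesis
    by (simp add: ennreal_add_left_cancel_le add.commute[of _ "ennreal (lam * mean_tw)"])
qed

abbreviation "opt lam \<equiv> opt_strategy tau_d tau1 g1 g2 lam"

text \<open>The outcome without any reference to the history. It exhibits the stage outcomes as one
  function of i.i.d. stages, which is what Wald's identity needs.\<close>

definition opt_res :: "real \<Rightarrow> stage \<Rightarrow> outcome" where
  "opt_res lam x =
    (let a = tau_d * log 2 (1 + gw x) - lam * tau_d; b = Wf (st_w x) (gw x) lam
     in if a \<ge> max b 0 then StopV2V else if a < 0 \<and> b < 0 then Cont False
        else if relay_rate (gw x) (zw x) \<ge> lam then StopRelay else Cont True)"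

lemma stage_res_opt: "stage_res (opt lam) h x = opt_res lam x"
  by (simp add: stage_res_def opt_strategy_def opt_res_def Let_def relay_rate_def)

lemma res_opt: "res (opt lam) \<omega> k = opt_res lam (\<omega> k)"
  by (simp add: res_def stage_res_opt)

lemma opt_res_measurable[measurable]: "opt_res lam \<in> SM \<rightarrow>\<^sub>M count_space UNIV"
proof -
  have [measurable]: "(\<lambda>p. relay_rate (fst p) (snd p)) \<in> borel_measurable (borel \<Otimes>\<^sub>M borel \<Otimes>\<^sub>M borel)"
    using relay_rate_measurable by (simp add: split_beta')
  show ?thesis
    unfolding opt_res_def[abs_def] Let_def
    by (rule measurable_winner_obs[where F="\<lambda>w g z.
        if tau_d * log 2 (1 + g) - lam * tau_d \<ge> max (Wf w g lam) 0 then StopV2V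
        else if tau_d * log 2 (1 + g) - lam * tau_d < 0 \<and> Wf w g lam < 0 then Cont False
        else if relay_rate g z \<ge> lam then StopRelay else Cont True"]) measurable
qed

text \<open>The second branch also covers re-contention, exactly as in \<open>reward\<close>, so
  that \<open>opt_reward\<close> holds on every run, stopped or not.\<close>

definition stage_reward :: "real \<Rightarrow> stage \<Rightarrow> real" where
  "stage_reward lam x = (if opt_res lam x = StopV2V then tau_d * log 2 (1 + gw x)
     else (tau_d - tau1) * relay_rate (gw x) (zw x))"

text \<open>Distributes \<open>cost\<close> over the stages: \<open>tau_d\<close> is booked where
  the run stops, and \<open>tau1\<close> only for a probe followed by re-contention, because after a
  probe that leads to transmission it is contained in \<open>tau_d\<close>.\<close>

definition stage_cost :: "real \<Rightarrow> stage \<Rightarrow> real" where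
  "stage_cost lam x = tw x + tau1 * of_bool (opt_res lam x = Cont True) + tau_d * of_bool (stops (opt_res lam x))"

lemma component_OM_measurable: "(\<lambda>\<omega>. \<omega> k) \<in> OM \<rightarrow>\<^sub>M SM"
  unfolding Omega_def by measurable

lemma stops_opt_res_measurable[measurable]: "Measurable.pred SM (\<lambda>x. stops (opt_res lam x))"
  by (rule measurable_compose[OF opt_res_measurable]) simp

lemma stage_cost_measurable[measurable]: "stage_cost lam \<in> borel_measurable SM"
  unfolding stage_cost_def[abs_def] by measurable

lemma stage_reward_measurable[measurable]: "stage_reward lam \<in> borel_measurable SM"
proof -
  have [measurable]: "(\<lambda>p. relay_rate (fst p) (snd p)) \<in> borel_measurable (borel \<Otimes>\<^sub>M borel \<Otimes>\<^sub>M borel)"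
    using relay_rate_measurable by (simp add: split_beta')
  have [measurable]: "(\<lambda>x. log 2 (1 + gw x)) \<in> borel_measurable SM"
    by (rule measurable_winner_obs[where F="\<lambda>w g z. log 2 (1 + g)"]) measurable
  have [measurable]: "(\<lambda>x. relay_rate (gw x) (zw x)) \<in> borel_measurable SM"
    by (rule measurable_winner_obs[where F="\<lambda>w g z. relay_rate g z"]) measurable
  show ?thesis unfolding stage_reward_def[abs_def] by measurable
qed

lemma stage_cost_nonneg: "0 \<le> stage_cost lam x"
  using tau tw_pos[of x] by (simp add: stage_cost_def)

text \<open>Every choice of the threshold rule attains the maximum in \<open>psi\<close>, so the
  one-stage comparisons apply in both directions. Here \<open>A\<close> and \<open>B\<close> belong
  to a single stage, not to the whole remaining run.\<close>

lemma nn_integral_stage_opt: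
  assumes lam: "0 < lam" "Phi lam = lam * mean_tw"
  shows "(\<integral>\<^sup>+x. ennreal (stage_reward lam x) * of_bool (stops (opt_res lam x)) \<partial>SM) =
    ennreal lam * (\<integral>\<^sup>+x. ennreal (stage_cost lam x) \<partial>SM)"
proof -
  let ?A = "\<lambda>x. ennreal (stage_reward lam x) * of_bool (stops (opt_res lam x))"
  let ?B = "\<lambda>x. ennreal (stage_cost lam x)"
  let ?a = "\<lambda>g. tau_d * log 2 (1 + g) - lam * tau_d"
  let ?d = "\<lambda>w g. \<not> ?a g \<ge> max (Wf w g lam) 0 \<and> \<not> (?a g < 0 \<and> Wf w g lam < 0)"
  have probe: "psi lam (st_w x) (gw x) = Wf (st_w x) (gw x) lam \<and>
      ?A x + ennreal (lam * tw x) + ennreal (lam * tau1) =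
      ennreal lam * ?B x + ennreal (pay lam (gw x) (zw x) + lam * tau1)" if d: "?d (st_w x) (gw x)" for x
  proof
    \<comment> \<open>Either the direct gain is nonnegative and \<open>W\<close> exceeds it, or it
      is negative and \<open>W\<close> is not.\<close>
    show "psi lam (st_w x) (gw x) = Wf (st_w x) (gw x) lam"
      using d unfolding psi_def by linarith
    let ?r = "relay_rate (gw x) (zw x)"
    have r: "opt_res lam x = (if ?r \<ge> lam then StopRelay else Cont True)"
      using d by (auto simp: opt_res_def Let_def)
    have t: "0 < lam * tau1" "0 < lam * tau_d" "0 < lam * tw x" "0 \<le> stage_cost lam x"
      using lam tau tw_pos[of x] stage_cost_nonneg by auto
    show "?A x + ennreal (lam * tw x) + ennreal (lam * tau1) =
        ennreal lam * ?B x + ennreal (pay lam (gw x) (zw x) + lam * tau1)"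
    \<comment> \<open>The threshold \<open>lam\<close> is where the branches of \<open>pay\<close>
      meet: \<open>(tau_d - tau1) * ?r - lam * tau_d \<ge> - lam * tau1\<close> means
      \<open>?r \<ge> lam\<close>.\<close>
    proof (cases "?r \<ge> lam")
      case True
      then have "(tau_d - tau1) * lam \<le> (tau_d - tau1) * ?r" using tau by (intro mult_left_mono) auto
      then have p: "pay lam (gw x) (zw x) = (tau_d - tau1) * ?r - lam * tau_d"
        unfolding pay_def by (simp add: algebra_simps)
      have y: "0 \<le> (tau_d - tau1) * ?r" using True tau lam by (intro mult_nonneg_nonneg) auto
      have "ennreal ((tau_d - tau1) * ?r) + ennreal (lam * tw x) + ennreal (lam * tau1) =
        ennreal (lam * (tw x + tau_d) + (pay lam (gw x) (zw x) + lam * tau1))"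
        using t y by (simp add: p algebra_simps flip: ennreal_plus)
      also have "\<dots> = ennreal lam * ennreal (tw x + tau_d) + ennreal (pay lam (gw x) (zw x) + lam * tau1)"
        using t lam tau tw_pos[of x] pay_ge[of lam "gw x" "zw x"]
        by (subst ennreal_plus) (auto simp: ennreal_mult simp del: ennreal_plus)
      finally show ?thesis
        using True r by (simp add: stage_reward_def stage_cost_def stops_def)
    next
      case False
      then have "(tau_d - tau1) * ?r \<le> (tau_d - tau1) * lam" using tau by (intro mult_left_mono) auto
      then have p: "pay lam (gw x) (zw x) + lam * tau1 = 0"
        unfolding pay_def by (simp add: algebra_simps)
      have "ennreal (lam * tw x) + ennreal (lam * tau1) = ennreal lam * ennreal (tw x + tau1)"
        using t lam tau tw_pos[of x]
        by (simp add: ennreal_mult[symmetric] ennreal_plus[symmetric] distrib_left del: ennreal_plus)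
      then show ?thesis
        unfolding p using False r by (simp add: stage_cost_def stops_def del: ennreal_plus)
    qed
  qed
  have no_probe: "?A x + ennreal (lam * tw x) = ennreal lam * ?B x + ennreal (psi lam (st_w x) (gw x)) \<and>
      psi lam (st_w x) (gw x) = max (?a (gw x)) 0" if d: "\<not> ?d (st_w x) (gw x)" for x
  proof (cases "?a (gw x) \<ge> max (Wf (st_w x) (gw x) lam) 0")
    case True
    then have r: "opt_res lam x = StopV2V" and psi: "psi lam (st_w x) (gw x) = ?a (gw x)"
      by (auto simp: opt_res_def psi_def)
    have t: "0 < lam * tau_d" "0 < lam * tw x" using lam tau tw_pos[of x] by auto
    have "ennreal (tau_d * log 2 (1 + gw x)) + ennreal (lam * tw x) = ennreal (lam * (tw x + tau_d) + ?a (gw x))"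
      using t True by (simp add: algebra_simps flip: ennreal_plus)
    also have "\<dots> = ennreal lam * ennreal (tw x + tau_d) + ennreal (?a (gw x))"
      using t True lam tau tw_pos[of x]
      by (subst ennreal_plus) (auto simp: ennreal_mult simp del: ennreal_plus)
    finally show ?thesis
      using True by (simp add: r psi stage_reward_def stage_cost_def stops_def)
  next
    case False
    with d have "?a (gw x) < 0" "Wf (st_w x) (gw x) lam < 0" by auto
    then have r: "opt_res lam x = Cont False" and psi: "psi lam (st_w x) (gw x) = 0" "max (?a (gw x)) 0 = 0"
      by (auto simp: opt_res_def psi_def)
    show ?thesis using lam tw_pos[of x] unfolding psi
      by (simp add: r stage_cost_def stops_def ennreal_mult)
  qed
  show ?thesis
  proof (rule antisym)
    show "(\<integral>\<^sup>+x. ?A x \<partial>SM) \<le> ennreal lam * (\<integral>\<^sup>+x. ?B x \<partial>SM)"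
    proof (rule nn_integral_stage_le[OF lam, where d="?d"])
      show "AE x in SM. ?d (st_w x) (gw x) \<longrightarrow> ?A x + ennreal (lam * tw x) + ennreal (lam * tau1)
          \<le> ennreal lam * ?B x + ennreal (pay lam (gw x) (zw x) + lam * tau1)"
        by (intro AE_I2 impI, drule probe) (metis order_refl)
      show "AE x in SM. \<not> ?d (st_w x) (gw x) \<longrightarrow> ?A x + ennreal (lam * tw x)
          \<le> ennreal lam * ?B x + ennreal (max (?a (gw x)) 0)"
        by (intro AE_I2 impI, drule no_probe) (metis order_refl)
    qed measurable
    show "ennreal lam * (\<integral>\<^sup>+x. ?B x \<partial>SM) \<le> (\<integral>\<^sup>+x. ?A x \<partial>SM)"
    proof (rule nn_integral_stage_ge[OF lam, where d="?d"])
      fix x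
      show "?d (st_w x) (gw x) \<Longrightarrow> psi lam (st_w x) (gw x) = Wf (st_w x) (gw x) lam \<and>
          ennreal lam * ?B x + ennreal (pay lam (gw x) (zw x) + lam * tau1)
            \<le> ?A x + ennreal (lam * tw x) + ennreal (lam * tau1)"
        by (drule probe) (metis order_refl)
      show "\<not> ?d (st_w x) (gw x) \<Longrightarrow>
          ennreal lam * ?B x + ennreal (psi lam (st_w x) (gw x)) \<le> ?A x + ennreal (lam * tw x)"
        by (drule no_probe) (metis order_refl)
    qed measurable
  qed
qed

lemma nn_integral_stage_cost:
  "(\<integral>\<^sup>+x. ennreal (stage_cost lam x) \<partial>SM) \<noteq> 0"
  "(\<integral>\<^sup>+x. ennreal (stage_cost lam x) \<partial>SM) < \<infinity>"
proof -
  interpret SM: prob_space SM by (rule prob_space_SM)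
  have "ennreal mean_tw \<le> (\<integral>\<^sup>+x. ennreal (stage_cost lam x) \<partial>SM)"
    unfolding nn_integral_SM_tw[symmetric] using tau
    by (intro nn_integral_mono ennreal_leI) (simp add: stage_cost_def)
  then show "(\<integral>\<^sup>+x. ennreal (stage_cost lam x) \<partial>SM) \<noteq> 0"
    using mean_tw_pos by (auto simp: ennreal_eq_0_iff)
  have "(\<integral>\<^sup>+x. ennreal (stage_cost lam x) \<partial>SM) \<le> (\<integral>\<^sup>+x. ennreal (tw x) + ennreal (tau1 + tau_d) \<partial>SM)"
  proof (rule nn_integral_mono)
    fix x
    have "ennreal (stage_cost lam x) \<le> ennreal (tw x + (tau1 + tau_d))"
      using tau by (intro ennreal_leI) (simp add: stage_cost_def)
    then show "ennreal (stage_cost lam x) \<le> ennreal (tw x) + ennreal (tau1 + tau_d)"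
      using tau tw_pos[of x] by (subst ennreal_plus[symmetric]) (auto simp del: ennreal_plus)
  qed
  also have "\<dots> = ennreal mean_tw + ennreal (tau1 + tau_d)"
    by (subst nn_integral_add) (simp_all add: nn_integral_SM_tw SM.emeasure_space_1 del: ennreal_plus)
  also have "\<dots> < \<infinity>" by simp
  finally show "(\<integral>\<^sup>+x. ennreal (stage_cost lam x) \<partial>SM) < \<infinity>" .
qed

lemma opt_stop_stage: "stop_stage (opt lam) \<omega> = (LEAST k. stops (opt_res lam (\<omega> k)))"
  by (simp add: stop_stage_def res_opt)

lemma opt_reward: "reward tau_d tau1 (opt lam) \<omega> = stage_reward lam (\<omega> (stop_stage (opt lam) \<omega>))"
  by (simp add: reward_def Let_def res_opt stage_reward_def relay_rate_def)

lemma opt_measurable: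
  "reward tau_d tau1 (opt lam) \<in> borel_measurable OM"
  "cost tauR tauC delta tau_d (opt lam) \<in> borel_measurable OM"
proof -
  note [measurable] = measurable_compose[OF component_OM_measurable stops_opt_res_measurable]
    measurable_compose[OF component_OM_measurable stage_reward_measurable]
    measurable_compose[OF component_OM_measurable tw_measurable]
    measurable_compose[OF component_OM_measurable opt_res_measurable]
  have N: "stop_stage (opt lam) \<in> OM \<rightarrow>\<^sub>M count_space UNIV"
    unfolding opt_stop_stage[abs_def] by measurable
  have "(\<lambda>\<omega>. stage_reward lam (\<omega> k)) \<in> borel_measurable OM" for k by measurable
  from measurable_compose_countable[OF this N]
  show "reward tau_d tau1 (opt lam) \<in> borel_measurable OM" by (simp add: opt_reward[abs_def])
  have "(\<lambda>\<omega>. (\<Sum>l\<le>k. tw (\<omega> l)) + tau1 * (\<Sum>l<k. of_bool (res (opt lam) \<omega> l = Cont True)) + tau_d)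
      \<in> borel_measurable OM" for k
    unfolding res_opt by measurable
  from measurable_compose_countable[OF this N]
  show "cost tauR tauC delta tau_d (opt lam) \<in> borel_measurable OM" by (simp add: cost_alt[abs_def])
qed

text \<open>Brings reward and cost into the form of sums up to a hitting time; the stop indicator
  removes all reward terms before the last.\<close>

lemma opt_at_stop:
  assumes "\<exists>k. stops (opt_res lam (\<omega> k))"
  shows "ennreal (reward tau_d tau1 (opt lam) \<omega>) = (\<Sum>n\<le>(LEAST k. stops (opt_res lam (\<omega> k))).
      ennreal (stage_reward lam (\<omega> n)) * of_bool (stops (opt_res lam (\<omega> n))))"
    and "ennreal (cost tauR tauC delta tau_d (opt lam) \<omega>) =
      (\<Sum>n\<le>(LEAST k. stops (opt_res lam (\<omega> k))). ennreal (stage_cost lam (\<omega> n)))"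
proof -
  define N where "N = (LEAST k. stops (opt_res lam (\<omega> k)))"
  have stop: "stops (opt_res lam (\<omega> N))" unfolding N_def using assms by (rule LeastI_ex)
  have less: "\<not> stops (opt_res lam (\<omega> n))" if "n < N" for n
    using that unfolding N_def by (rule not_less_Least)
  have N: "stop_stage (opt lam) \<omega> = N" by (simp add: opt_stop_stage N_def)
  have "(\<Sum>n<N. ennreal (stage_reward lam (\<omega> n)) * of_bool (stops (opt_res lam (\<omega> n)))) = 0"
    by (rule sum.neutral) (simp add: less)
  then show "ennreal (reward tau_d tau1 (opt lam) \<omega>) = (\<Sum>n\<le>(LEAST k. stops (opt_res lam (\<omega> k))).
      ennreal (stage_reward lam (\<omega> n)) * of_bool (stops (opt_res lam (\<omega> n))))"
    unfolding N_def[symmetric] lessThan_Suc_atMost[symmetric] sum.lessThan_Suc opt_reward N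
    by (simp add: stop)
  have "stage_cost lam (\<omega> N) = tw (\<omega> N) + tau_d"
    using stop by (auto simp: stage_cost_def stops_def)
  moreover have "(\<Sum>n<N. stage_cost lam (\<omega> n)) =
      (\<Sum>n<N. tw (\<omega> n) + tau1 * of_bool (opt_res lam (\<omega> n) = Cont True))"
    by (rule sum.cong) (simp_all add: stage_cost_def less)
  ultimately have "cost tauR tauC delta tau_d (opt lam) \<omega> = (\<Sum>n\<le>N. stage_cost lam (\<omega> n))"
    unfolding cost_alt N res_opt lessThan_Suc_atMost[symmetric] sum.lessThan_Suc
    by (simp only: sum.distrib sum_distrib_left)
  then show "ennreal (cost tauR tauC delta tau_d (opt lam) \<omega>) =
      (\<Sum>n\<le>(LEAST k. stops (opt_res lam (\<omega> k))). ennreal (stage_cost lam (\<omega> n)))"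
    unfolding N_def[symmetric] by (simp add: stage_cost_nonneg sum_ennreal)
qed

text \<open>Wald's identity divides the one-stage means of reward and cost by the same stopping
  probability, which cancels in the ratio.\<close>

lemma opt_attains:
  assumes lam: "0 < lam" "Phi lam = lam * mean_tw"
  shows "admissible OM (reward tau_d tau1) (cost tauR tauC delta tau_d) (opt lam)"
    and "ratio OM (reward tau_d tau1) (cost tauR tauC delta tau_d) (opt lam) = ennreal lam"
proof -
  interpret SM: prob_space SM by (rule prob_space_SM)
  let ?Q = "\<lambda>x. stops (opt_res lam x)"
  let ?A = "\<lambda>x. ennreal (stage_reward lam x) * of_bool (?Q x)"
  let ?p = "emeasure SM {x \<in> space SM. ?Q x}"
  let ?IA = "\<integral>\<^sup>+x. ?A x \<partial>SM" and ?IB = "\<integral>\<^sup>+x. ennreal (stage_cost lam x) \<partial>SM"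
  have Q: "Measurable.pred SM ?Q" by measurable
  have IA: "?IA = ennreal lam * ?IB" by (rule nn_integral_stage_opt[OF lam])
  \<comment> \<open>If the rule almost surely did not stop in a stage, the one-stage reward would
    have mean 0, yet this mean is \<open>lam\<close> times a positive mean cost.\<close>
  have p: "?p \<noteq> 0"
  proof
    assume "?p = 0"
    then have "AE x in SM. \<not> ?Q x" by (subst AE_iff_measurable[OF _ refl]) auto
    then have "?IA = (\<integral>\<^sup>+x. 0 \<partial>SM)" by (intro nn_integral_cong_AE) (auto elim: eventually_mono)
    with IA lam nn_integral_stage_cost(1) show False by simp
  qed
  have hit: "AE \<omega> in OM. \<exists>k. ?Q (\<omega> k)"
    unfolding Omega_def by (rule AE_PiM_hits[OF prob_space_SM Q p])
  have Y: "(\<integral>\<^sup>+\<omega>. ennreal (reward tau_d tau1 (opt lam) \<omega>) \<partial>OM) = ?IA / ?p"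
  proof -
    have "(\<integral>\<^sup>+\<omega>. ennreal (reward tau_d tau1 (opt lam) \<omega>) \<partial>OM) = (\<integral>\<^sup>+\<omega>. (\<Sum>n\<le>(LEAST k. ?Q (\<omega> k)). ?A (\<omega> n)) \<partial>OM)"
      by (rule nn_integral_cong_AE, use hit in eventually_elim) (rule opt_at_stop(1))
    also have "\<dots> = ?IA / ?p"
      unfolding Omega_def by (rule nn_integral_PiM_sum_until_hit[OF prob_space_SM Q p]) measurable
    finally show ?thesis .
  qed
  have T: "(\<integral>\<^sup>+\<omega>. ennreal (cost tauR tauC delta tau_d (opt lam) \<omega>) \<partial>OM) = ?IB / ?p"
  proof -
    have "(\<integral>\<^sup>+\<omega>. ennreal (cost tauR tauC delta tau_d (opt lam) \<omega>) \<partial>OM) =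
        (\<integral>\<^sup>+\<omega>. (\<Sum>n\<le>(LEAST k. ?Q (\<omega> k)). ennreal (stage_cost lam (\<omega> n))) \<partial>OM)"
      by (rule nn_integral_cong_AE, use hit in eventually_elim) (rule opt_at_stop(2))
    also have "\<dots> = ?IB / ?p"
      unfolding Omega_def by (rule nn_integral_PiM_sum_until_hit[OF prob_space_SM Q p]) measurable
    finally show ?thesis .
  qed
  have fin: "?IB / ?p < \<infinity>"
    using nn_integral_stage_cost(2) p by (simp add: ennreal_divide_eq_top_iff less_top[symmetric])
  have "?IB / ?p \<noteq> 0"
    using nn_integral_stage_cost(1) by (simp add: ennreal_divide_eq_0_iff)
  then show "ratio OM (reward tau_d tau1) (cost tauR tauC delta tau_d) (opt lam) = ennreal lam"
    unfolding ratio_def Y T IA using fin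
    by (simp add: ennreal_times_divide[symmetric] ennreal_mult_divide_eq)
  show "admissible OM (reward tau_d tau1) (cost tauR tauC delta tau_d) (opt lam)"
    unfolding admissible_def T using hit fin opt_measurable by (simp add: res_opt)
qed

lemma ratio_le:
  assumes lam: "0 < lam" "Phi lam = lam * mean_tw"
    and H: "admissible OM (reward tau_d tau1) (cost tauR tauC delta tau_d) H"
  shows "ratio OM (reward tau_d tau1) (cost tauR tauC delta tau_d) H \<le> ennreal lam"
proof -
  interpret OM: prob_space OM by (rule prob_space_OM)
  let ?T = "\<integral>\<^sup>+\<omega>. ennreal (cost tauR tauC delta tau_d H \<omega>) \<partial>OM"
  \<comment> \<open>The division requires a mean cost that is neither 0 nor infinite:
    \<open>tau_d\<close> bounds it from below, admissibility from above.\<close>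
  have "(\<integral>\<^sup>+\<omega>. ennreal tau_d \<partial>OM) \<le> ?T" by (intro nn_integral_mono ennreal_leI cost_ge)
  then have "ennreal tau_d \<le> ?T" by (simp add: OM.emeasure_space_1)
  then have T: "?T \<noteq> 0" "?T \<noteq> \<infinity>" using tau H by (auto simp: admissible_def ennreal_eq_0_iff)
  have "ratio OM (reward tau_d tau1) (cost tauR tauC delta tau_d) H \<le> ennreal lam * ?T / ?T"
    unfolding ratio_def by (intro divide_right_mono_ennreal reward_le_cost[OF lam H])
  also have "\<dots> = ennreal lam" using T by (simp add: ennreal_mult_divide_eq)
  finally show ?thesis .
qed

end

section \<open>Supremum, fixed point and optimal strategy combined\<close>

theorem theorem1:
  fixes K :: nat and Ps Pr N0 alpha1 alpha2 tauR tauC delta tau_d p0 :: real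
    and xS xD :: "nat \<Rightarrow> 'v::euclidean_space" and xR :: 'v
  assumes "K \<ge> 1" and "Ps > 0" and "Pr > 0" and "N0 > 0" and "alpha1 > 0" and "alpha2 > 0"
    and "\<And>i. i \<in> {1..K} \<Longrightarrow> norm (xS i - xD i) > 0"
    and "\<And>i. i \<in> {1..K} \<Longrightarrow> norm (xS i - xR) > 0"
    and "\<And>i. i \<in> {1..K} \<Longrightarrow> norm (xR - xD i) > 0"
    and "tauR > 0" and "tauC > 0" and "delta > 0" and "tau_d > tauR + tauC"
    and "0 < p0" and "p0 < 1"
  defines "M \<equiv> Omega p0 K (gbarD Ps N0 alpha1 xS xD) (gbar1 Ps N0 alpha2 xS xR) (gbar2 Pr N0 alpha2 xR xD)"
    and "Y \<equiv> reward tau_d (tauR + tauC)"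
    and "T \<equiv> cost tauR tauC delta tau_d"
    and "eqn \<equiv> \<lambda>lam. (\<integral>x. max (max (tau_d * log 2 (1 + st_g x (st_w x)) - lam * tau_d) 0)
                               (W tau_d (tauR + tauC) (gbar1 Ps N0 alpha2 xS xR) (gbar2 Pr N0 alpha2 xR xD) (st_w x) (st_g x (st_w x)) lam)
                        \<partial>stage_M p0 K (gbarD Ps N0 alpha1 xS xD) (gbar1 Ps N0 alpha2 xS xR) (gbar2 Pr N0 alpha2 xR xD)) = lam * tau_o p0 K tauR tauC delta"
  shows "\<exists>lam_s > 0.
           (SUP H \<in> {H. admissible M Y T H}. ratio M Y T H) = ennreal lam_s
         \<and> eqn lam_s \<and> (\<forall>lam > 0. eqn lam \<longrightarrow> lam = lam_s)
         \<and> admissible M Y T (opt_strategy tau_d (tauR + tauC) (gbar1 Ps N0 alpha2 xS xR) (gbar2 Pr N0 alpha2 xR xD) lam_s)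
         \<and> ratio M Y T (opt_strategy tau_d (tauR + tauC) (gbar1 Ps N0 alpha2 xS xR) (gbar2 Pr N0 alpha2 xR xD) lam_s) = ennreal lam_s"
proof -
  interpret rsu_access K p0 tauR tauC delta tau_d
    "gbarD Ps N0 alpha1 xS xD" "gbar1 Ps N0 alpha2 xS xR" "gbar2 Pr N0 alpha2 xR xD"
    using assms(1-15) by unfold_locales (auto simp: gbarD_def gbar1_def gbar2_def)
  have eqn: "eqn lam \<longleftrightarrow> Phi lam = lam * mean_tw" for lam
    by (simp add: eqn_def Phi_def psi_def)
  obtain lam where lam: "0 < lam" "Phi lam = lam * mean_tw"
    using Phi_root by auto
  note opt = opt_attains[OF lam, folded M_def Y_def T_def]
  have "(SUP H \<in> {H. admissible M Y T H}. ratio M Y T H) = ennreal lam"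
  proof (rule antisym)
    show "(SUP H \<in> {H. admissible M Y T H}. ratio M Y T H) \<le> ennreal lam"
      using ratio_le[OF lam, folded M_def Y_def T_def] by (intro SUP_least) simp
    show "ennreal lam \<le> (SUP H \<in> {H. admissible M Y T H}. ratio M Y T H)"
      unfolding opt(2)[symmetric] using opt(1) by (intro SUP_upper) simp
  qed
  moreover have "mu = lam" if "0 < mu" "eqn mu" for mu
    using Phi_root_unique[OF that(1) lam(1) _ lam(2)] that(2) unfolding eqn .
  ultimately show ?thesis
    using lam opt unfolding eqn by blast
qed

end
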